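(* Let $(X,\varphi)$ be a Cantor minimal system. The following three conditions are equivalent. (1) $(X,\varphi)$ is not an odometer. (2) The commutator subgroup $D([[\varphi]])$ of the topological full group $[[\varphi]]$ contains the lamplighter group $L$ (i.e. has a subgroup isomorphic to $L$). (3) The topological full group $[[\varphi]]$ contains the lamplighter group $L$ (i.e. has a subgroup isomorphic to $L$).
   Context: A Cantor set is a non-empty compact metrizable totally disconnected space without isolated points. A Cantor minimal system $(X,\varphi)$ is a Cantor set $X$ with a homeomorphism $\varphi:X\to X$ all of whose orbits $\{\varphi^n(x)\mid n\in\mathbb{Z}\}$ are dense in $X$. Topological full group: $[[\varphi]]$ is the group (under composition) of all homeomorphisms $\psi:X\to X$ for which there exists a continuous map $c:X\to\mathbb{Z}$ such that $\psi(x)=\varphi^{c(x)}(x)$ for all $x\in X$. $D(\Gamma)$ denotes the commutator subgroup of a group $\Gamma$. Odometer: write $\mathbb{Z}_m=\mathbb{Z}/m\mathbb{Z}$. Let $(m_n)_n$ be a sequence of natural numbers with $m_n\mid m_{n+1}$ and $m_n\to\infty$, and let $\rho_n:\mathbb{Z}_{m_{n+1}}\to\mathbb{Z}_{m_n}$ be the surjective homomorphism with $\rho_n(1)=1$. The odometer of type $(m_n)_n$ is the system $(Y,\psi)$ where $Y=\{(y_n)_n\in\prod_n\mathbb{Z}_{m_n}\mid\rho_n(y_{n+1})=y_n\text{ for all }n\}$ with the product topology and $\psi((y_n)_n)=(y_n+1)_n$. A Cantor minimal system $(X,\varphi)$ is said to be an odometer if it is conjugate to the odometer of type $(m_n)_n$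 for some such sequence, i.e. there is a homeomorphism $f:X\to Y$ with $f\circ\varphi=\psi\circ f$. The lamplighter group is the wreath product $L=\left(\bigoplus_{\mathbb{Z}}\mathbb{Z}/2\mathbb{Z}\right)\rtimes\mathbb{Z}$, where $\mathbb{Z}$ acts by the shift on the index set. *)

theory Defs
  imports "HOL-Analysis.Analysis" "HOL-Algebra.Bij" "HOL-Algebra.Product_Groups"
begin

section \<open>Cantor minimal systems\<close>

definition cantor_space :: "'a topology \<Rightarrow> bool" where
  "cantor_space X \<longleftrightarrow>
     topspace X \<noteq> {} \<and> compact_space X \<and> metrizable_space X \<and>
     (\<forall>C. connectedin X C \<longrightarrow> (\<exists>a. C \<subseteq> {a})) \<and>
     (\<forall>x\<in>topspace X. \<not> openin X {x})"

text \<open>Integer iterates of a bijection of \<open>S\<close>; only meaningful at points of \<open>S\<close>.\<close>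

definition int_iterate :: "'a set \<Rightarrow> ('a \<Rightarrow> 'a) \<Rightarrow> int \<Rightarrow> 'a \<Rightarrow> 'a" where
  "int_iterate S \<phi> n =
     (if 0 \<le> n then \<phi> ^^ nat n else inv_into S \<phi> ^^ nat (- n))"

definition cantor_minimal_system :: "'a topology \<Rightarrow> ('a \<Rightarrow> 'a) \<Rightarrow> bool" where
  "cantor_minimal_system X \<phi> \<longleftrightarrow>
     cantor_space X \<and> homeomorphic_map X X \<phi> \<and>
     (\<forall>x\<in>topspace X. X closure_of (range (\<lambda>n. int_iterate (topspace X) \<phi> n x)) = topspace X)"

section \<open>The topological full group\<close>

text \<open>
  As in \<open>BijGroup\<close>, self-maps of \<open>topspace X\<close> are represented by extensional functions, so that
  equality of group elements is equality as maps on \<open>topspace X\<close>.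
\<close>

definition full_group :: "'a topology \<Rightarrow> ('a \<Rightarrow> 'a) \<Rightarrow> ('a \<Rightarrow> 'a) monoid" where
  "full_group X \<phi> = BijGroup (topspace X)
     \<lparr>carrier := {\<psi> \<in> Bij (topspace X). homeomorphic_map X X \<psi> \<and>
        (\<exists>c. continuous_map X (discrete_topology (UNIV :: int set)) c \<and>
             (\<forall>x\<in>topspace X. \<psi> x = int_iterate (topspace X) \<phi> (c x) x))}\<rparr>"

definition commutator_subgroup :: "('a, 'b) monoid_scheme \<Rightarrow> ('a, 'b) monoid_scheme" where
  "commutator_subgroup G = G\<lparr>carrier := derived G (carrier G)\<rparr>"

definition contains_copy_of :: "('a, 'c) monoid_scheme \<Rightarrow> ('b, 'd) monoid_scheme \<Rightarrow> bool" where
  "contains_copy_of G L \<longleftrightarrow> (\<exists>H. subgroup H G \<and> L \<cong> G\<lparr>carrier := H\<rparr>)"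

section \<open>Odometers\<close>

text \<open>
  \<open>\<int>/m\<int>\<close> is represented by its residues \<open>{0..<int m}\<close>, as in \<open>integer_mod_group\<close>; the
  transition map \<open>\<rho>\<^sub>n\<close> is then reduction modulo \<open>m n\<close>.
\<close>

definition odometer_type :: "(nat \<Rightarrow> nat) \<Rightarrow> bool" where
  "odometer_type m \<longleftrightarrow>
     (\<forall>n. 0 < m n \<and> m n dvd m (Suc n)) \<and> filterlim m at_top sequentially"

definition odometer_space :: "(nat \<Rightarrow> nat) \<Rightarrow> (nat \<Rightarrow> int) topology" where
  "odometer_space m =
     subtopology
       (product_topology (\<lambda>n. discrete_topology (carrier (integer_mod_group (m n)))) UNIV)
       {y. \<forall>n. y (Suc n) mod int (m n) = y n}"

definition odometer_map :: "(nat \<Rightarrow> nat) \<Rightarrow> (nat \<Rightarrow> int) \<Rightarrow> (nat \<Rightarrow> int)" where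
  "odometer_map m y = (\<lambda>n. (y n + 1) mod int (m n))"

definition is_odometer :: "'a topology \<Rightarrow> ('a \<Rightarrow> 'a) \<Rightarrow> bool" where
  "is_odometer X \<phi> \<longleftrightarrow>
     (\<exists>m. odometer_type m \<and>
       (\<exists>f. homeomorphic_map X (odometer_space m) f \<and>
            (\<forall>x\<in>topspace X. f (\<phi> x) = odometer_map m (f x))))"

section \<open>The lamplighter group\<close>

text \<open>Here \<open>\<alpha>\<close> is meant to be an action of \<open>H\<close> on \<open>G\<close> by automorphisms.\<close>

definition semidirect_product ::
  "('a, 'c) monoid_scheme \<Rightarrow> ('b \<Rightarrow> 'a \<Rightarrow> 'a) \<Rightarrow> ('b, 'd) monoid_scheme \<Rightarrow> ('a \<times> 'b) monoid" where
  "semidirect_product G \<alpha> H =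
     \<lparr>carrier = carrier G \<times> carrier H,
      mult = (\<lambda>(g, h) (g', h'). (g \<otimes>\<^bsub>G\<^esub> \<alpha> h g', h \<otimes>\<^bsub>H\<^esub> h')),
      one = (\<one>\<^bsub>G\<^esub>, \<one>\<^bsub>H\<^esub>)\<rparr>"

definition lamplighter_group :: "((int \<Rightarrow> int) \<times> int) monoid" where
  "lamplighter_group =
     semidirect_product
       (sum_group (UNIV :: int set) (\<lambda>_. integer_mod_group 2))
       (\<lambda>k f i. f (i - k))
       integer_group"

section \<open>Well-definedness\<close>

lemma int_iterate_zero [simp]: "int_iterate S \<phi> 0 x = x"
  by (simp add: int_iterate_def)

lemma int_iterate_closed:
  assumes "bij_betw \<phi> S S" "x \<in> S"
  shows "int_iterate S \<phi> n x \<in> S"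
proof -
  have "(f ^^ k) x \<in> S" if "f \<in> S \<rightarrow> S" for f :: "'a \<Rightarrow> 'a" and k
    using that assms(2) by (induction k) auto
  moreover have "\<phi> \<in> S \<rightarrow> S" "inv_into S \<phi> \<in> S \<rightarrow> S"
    using assms(1) bij_betw_inv_into bij_betw_imp_funcset by blast+
  ultimately show ?thesis
    by (auto simp: int_iterate_def)
qed

lemma int_iterate_step:
  assumes "bij_betw \<phi> S S" "x \<in> S"
  shows "int_iterate S \<phi> (n + 1) x = \<phi> (int_iterate S \<phi> n x)"
proof (cases "0 \<le> n")
  case True
  then have "nat (n + 1) = Suc (nat n)" by simp
  with True show ?thesis by (simp add: int_iterate_def)
next
  case False
  define k where "k = nat (- (n + 1))"
  have n: "n = - int (Suc k)" using False by (simp add: k_def)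
  have *: "int_iterate S \<phi> (- int j) = inv_into S \<phi> ^^ j" for j
    by (cases j) (auto simp: int_iterate_def simp del: of_nat_Suc)
  have 1: "int_iterate S \<phi> (n + 1) x = (inv_into S \<phi> ^^ k) x"
    using *[of k] n by simp
  have "(inv_into S \<phi> ^^ k) x \<in> S"
    using int_iterate_closed[OF assms, of "- int k"] * by simp
  then have "\<phi> ((inv_into S \<phi> ^^ Suc k) x) = (inv_into S \<phi> ^^ k) x"
    using assms(1) by (simp add: bij_betw_inv_into_right)
  then show ?thesis using 1 *[of "Suc k"] n by simp
qed

lemma int_iterate_add:
  assumes "bij_betw \<phi> S S" "x \<in> S"
  shows "int_iterate S \<phi> (m + n) x = int_iterate S \<phi> m (int_iterate S \<phi> n x)"
proof (induction m rule: int_induct[where k = 0])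
  case base
  then show ?case by simp
next
  case (step1 i)
  then show ?case
    using int_iterate_step[OF assms, of "i + n"]
      int_iterate_step[OF assms(1) int_iterate_closed[OF assms], of i n]
    by (simp add: algebra_simps)
next
  case (step2 i)
  let ?y = "int_iterate S \<phi> n x"
  have "\<phi> (int_iterate S \<phi> (i - 1 + n) x) = \<phi> (int_iterate S \<phi> (i - 1) ?y)"
    using step2 int_iterate_step[OF assms, of "i - 1 + n"]
      int_iterate_step[OF assms(1) int_iterate_closed[OF assms], of "i - 1" n]
    by (simp add: algebra_simps)
  then show ?case
    using assms int_iterate_closed bij_betw_imp_inj_on inj_on_eq_iff by metis
qed

lemma subgroup_full_group:
  assumes "homeomorphic_map X X \<phi>"
  shows "subgroup (carrier (full_group X \<phi>)) (BijGroup (topspace X))"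
proof -
  let ?S = "topspace X" and ?F = "carrier (full_group X \<phi>)"
  let ?Z = "discrete_topology (UNIV :: int set)"
  interpret B: group "BijGroup ?S" by (rule group_BijGroup)
  have bij: "bij_betw \<phi> ?S ?S"
    using assms by (simp add: bij_betw_def homeomorphic_imp_injective_map
        homeomorphic_imp_surjective_map)
  note add = int_iterate_add[OF bij]
  have F: "\<psi> \<in> ?F \<longleftrightarrow> \<psi> \<in> Bij ?S \<and> homeomorphic_map X X \<psi> \<and>
        (\<exists>c. continuous_map X ?Z c \<and> (\<forall>x\<in>?S. \<psi> x = int_iterate ?S \<phi> (c x) x))" for \<psi>
    by (simp add: full_group_def)
  have sub: "?F \<subseteq> carrier (BijGroup ?S)"
    by (auto simp: F BijGroup_def)
  show ?thesis
  proof (rule B.subgroupI)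
    show "?F \<subseteq> carrier (BijGroup ?S)" by (rule sub)
    have "homeomorphic_map X X (\<lambda>x\<in>?S. x)"
      by (rule homeomorphic_map_eq[OF homeomorphic_map_id[THEN iffD2, of X X]]) auto
    then have "(\<lambda>x\<in>?S. x) \<in> ?F"
      unfolding F using id_Bij by (auto intro!: exI[of _ "\<lambda>_. 0"])
    then show "?F \<noteq> {}" by blast
  next
    fix \<psi> assume "\<psi> \<in> ?F"
    then obtain c where \<psi>: "\<psi> \<in> Bij ?S" "homeomorphic_map X X \<psi>"
      and c: "continuous_map X ?Z c" "\<And>x. x \<in> ?S \<Longrightarrow> \<psi> x = int_iterate ?S \<phi> (c x) x"
      by (auto simp: F)
    let ?i = "inv_into ?S \<psi>"
    let ?r = "restrict ?i ?S"
    have b: "bij_betw \<psi> ?S ?S" using \<psi>(1) by (simp add: Bij_def)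
    have inS: "?i x \<in> ?S" if "x \<in> ?S" for x
      using that b bij_betw_inv_into bij_betwE by metis
    have right: "\<psi> (?i x) = x" if "x \<in> ?S" for x
      using that b by (simp add: bij_betw_inv_into_right)
    obtain g where g: "homeomorphic_maps X X \<psi> g"
      using \<psi>(2) homeomorphic_map_maps by blast
    have geq: "g x = ?r x" if "x \<in> ?S" for x
      using that g inS[OF that] right[OF that] unfolding homeomorphic_maps_def
      by (metis restrict_apply')
    have "homeomorphic_map X X g"
      using g homeomorphic_maps_map by blast
    then have h: "homeomorphic_map X X ?r"
      by (rule homeomorphic_map_eq) (simp add: geq)
    have "continuous_map X ?Z (c \<circ> ?r)"
      using continuous_map_compose[OF homeomorphic_imp_continuous_map[OF h] c(1)] .
    then have "continuous_map X ?Z (uminus \<circ> (c \<circ> ?r))"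
      by (rule continuous_map_compose) simp
    moreover have "?r x = int_iterate ?S \<phi> ((uminus \<circ> (c \<circ> ?r)) x) x" if x: "x \<in> ?S" for x
    proof -
      have "int_iterate ?S \<phi> (- c (?i x)) (\<psi> (?i x)) = ?i x"
        using c(2)[OF inS[OF x]] add[OF inS[OF x], of "- c (?i x)" "c (?i x)"] by simp
      then show ?thesis using x right[OF x] by simp
    qed
    ultimately have "?r \<in> ?F"
      unfolding F using h restrict_inv_into_Bij[OF \<psi>(1)] by blast
    moreover have "inv\<^bsub>BijGroup ?S\<^esub> \<psi> = ?r"
      using \<psi>(1) by (rule inv_BijGroup)
    ultimately show "inv\<^bsub>BijGroup ?S\<^esub> \<psi> \<in> ?F" by simp
  next
    fix \<psi>1 \<psi>2 assume "\<psi>1 \<in> ?F" "\<psi>2 \<in> ?F"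
    then obtain c1 c2 where
      \<psi>: "\<psi>1 \<in> Bij ?S" "homeomorphic_map X X \<psi>1" "\<psi>2 \<in> Bij ?S" "homeomorphic_map X X \<psi>2"
      and c: "continuous_map X ?Z c1" "\<And>x. x \<in> ?S \<Longrightarrow> \<psi>1 x = int_iterate ?S \<phi> (c1 x) x"
        "continuous_map X ?Z c2" "\<And>x. x \<in> ?S \<Longrightarrow> \<psi>2 x = int_iterate ?S \<phi> (c2 x) x"
      by (auto simp: F)
    have h: "homeomorphic_map X X (compose ?S \<psi>1 \<psi>2)"
      by (rule homeomorphic_map_eq[OF homeomorphic_map_compose[OF \<psi>(4,2)]])
        (simp add: compose_def)
    have c1': "continuous_map X ?Z (c1 \<circ> \<psi>2)"
      using continuous_map_compose[OF homeomorphic_imp_continuous_map[OF \<psi>(4)] c(1)] .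
    have "continuous_map X ?Z (\<lambda>x. (c1 \<circ> \<psi>2) x + c2 x)"
    proof -
      have "continuous_map X (prod_topology ?Z ?Z) (\<lambda>x. ((c1 \<circ> \<psi>2) x, c2 x))"
        using c1' c(3) by (rule continuous_map_pairedI)
      moreover have "continuous_map (prod_topology ?Z ?Z) ?Z (\<lambda>(a, b). a + b)"
        by (simp flip: prod_topology_discrete_topology)
      ultimately show ?thesis
        using continuous_map_compose by (fastforce simp: o_def)
    qed
    moreover have "compose ?S \<psi>1 \<psi>2 x = int_iterate ?S \<phi> ((c1 \<circ> \<psi>2) x + c2 x) x"
      if x: "x \<in> ?S" for x
    proof -
      have "\<psi>2 x \<in> ?S" using \<psi>(3) x Bij_imp_funcset by blast
      then show ?thesis using x c(2,4) add[OF x] by (simp add: compose_def)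
    qed
    ultimately have "compose ?S \<psi>1 \<psi>2 \<in> ?F"
      unfolding F using h compose_Bij[OF \<psi>(1,3)] by blast
    then show "\<psi>1 \<otimes>\<^bsub>BijGroup ?S\<^esub> \<psi>2 \<in> ?F"
      using \<psi> by (simp add: BijGroup_def)
  qed
qed

lemma group_full_group:
  assumes "homeomorphic_map X X \<phi>"
  shows "group (full_group X \<phi>)"
proof -
  have "full_group X \<phi> = BijGroup (topspace X)\<lparr>carrier := carrier (full_group X \<phi>)\<rparr>"
    by (simp add: full_group_def)
  then show ?thesis
    using subgroup.subgroup_is_group[OF subgroup_full_group[OF assms] group_BijGroup] by simp
qed

lemma group_lamplighter_group: "group lamplighter_group"
proof -
  let ?A = "sum_group (UNIV :: int set) (\<lambda>_. integer_mod_group 2)"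
  interpret A: group ?A by simp
  have carr: "carrier ?A = {f. (\<forall>i. f i \<in> {0..<2}) \<and> finite {i. f i \<noteq> 0}}"
    by (auto simp: carrier_sum_group carrier_integer_mod_group PiE_iff)
  have mult: "f \<otimes>\<^bsub>?A\<^esub> g = (\<lambda>i. (f i + g i) mod 2)" for f g
    by (simp add: fun_eq_iff)
  have one: "\<one>\<^bsub>?A\<^esub> = (\<lambda>_. 0)"
    by (simp add: fun_eq_iff)
  have shift: "(\<lambda>i. f (i - k)) \<in> carrier ?A" if "f \<in> carrier ?A" for f and k :: int
  proof -
    have "{i. f (i - k) \<noteq> 0} = (\<lambda>i. i + k) ` {i. f i \<noteq> 0}"
      by (force simp: image_iff)
    then show ?thesis using that by (simp add: carr)
  qed
  show ?thesis
  proof (rule groupI)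
    fix x y z
    assume x: "x \<in> carrier lamplighter_group" and y: "y \<in> carrier lamplighter_group"
      and z: "z \<in> carrier lamplighter_group"
    show "x \<otimes>\<^bsub>lamplighter_group\<^esub> y \<otimes>\<^bsub>lamplighter_group\<^esub> z =
        x \<otimes>\<^bsub>lamplighter_group\<^esub> (y \<otimes>\<^bsub>lamplighter_group\<^esub> z)"
      by (cases x; cases y; cases z)
        (simp add: lamplighter_group_def semidirect_product_def mult fun_eq_iff
          mod_simps algebra_simps)
  next
    fix x y assume "x \<in> carrier lamplighter_group" "y \<in> carrier lamplighter_group"
    then show "x \<otimes>\<^bsub>lamplighter_group\<^esub> y \<in> carrier lamplighter_group"
      using shift A.m_closed
      by (cases x; cases y) (simp add: lamplighter_group_def semidirect_product_def del: mult_sum_group)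
  next
    show "\<one>\<^bsub>lamplighter_group\<^esub> \<in> carrier lamplighter_group"
      by (simp add: lamplighter_group_def semidirect_product_def carr one)
  next
    fix x assume "x \<in> carrier lamplighter_group"
    then obtain f k where x: "x = (f, k)" and f: "f \<in> carrier ?A"
      by (cases x) (auto simp: lamplighter_group_def semidirect_product_def)
    have f01: "0 \<le> f i" "f i < 2" for i using f by (auto simp: carr)
    show "\<one>\<^bsub>lamplighter_group\<^esub> \<otimes>\<^bsub>lamplighter_group\<^esub> x = x"
      using f01 by (simp add: x lamplighter_group_def semidirect_product_def mult one fun_eq_iff)
    have "(\<lambda>i. f (i - (- k)), - k) \<otimes>\<^bsub>lamplighter_group\<^esub> x = \<one>\<^bsub>lamplighter_group\<^esub>"
      by (simp add: x lamplighter_group_def semidirect_product_def mult one fun_eq_iff)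
    moreover have "(\<lambda>i. f (i - (- k)), - k) \<in> carrier lamplighter_group"
      using shift[OF f, of "- k"] by (simp add: lamplighter_group_def semidirect_product_def)
    ultimately show "\<exists>y\<in>carrier lamplighter_group.
        y \<otimes>\<^bsub>lamplighter_group\<^esub> x = \<one>\<^bsub>lamplighter_group\<^esub>" by blast
  qed
qed

end

theory Submission
  imports Defs "HOL-Combinatorics.Cycles"
begin


text \<open>
  If \<open>\<phi>\<close> is not an odometer, take a clopen \<open>B\<close> whose first four translates \<open>B, \<phi>(B), \<phi>\<^sup>2(B), \<phi>\<^sup>3(B)\<close>
  are disjoint, and let \<open>g\<close> be the first return map of \<open>B\<close>. For clopen \<open>E \<subseteq> B\<close> let \<open>a\<^sub>E\<close> exchange \<open>E\<close> with
  \<open>\<phi>(E)\<close>, and let \<open>t\<close> act as \<open>g\<close> on \<open>B\<close> and as its conjugate on \<open>\<phi>(B)\<close>. Then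
  \<open>a\<^sub>E a\<^sub>F = a\<^sub>H\<close> for the symmetric difference \<open>H\<close> of \<open>E\<close> and \<open>F\<close>, and conjugation by \<open>t\<close> sends \<open>a\<^sub>E\<close> to the
  exchange of \<open>g(E)\<close>; so \<open>a\<^sub>E\<close> and \<open>t\<close> generate a lamplighter group unless the indicator of \<open>E\<close> satisfies a
  linear recurrence modulo 2 along \<open>g\<close>-orbits, that is, unless \<open>E\<close> is \<open>g\<close>-periodic. If all \<open>E\<close> were
  \<open>g\<close>-periodic, then all clopen subsets of \<open>X\<close> would be \<open>\<phi>\<close>-periodic and \<open>\<phi>\<close> an odometer. Commutators with the
  involution that exchanges \<open>B \<union> \<phi>(B)\<close> with its image under \<open>\<phi>\<^sup>2\<close> move the lamplighter group into the
  commutator subgroup.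

  Conversely, every finite set of elements of the full group of an odometer acts on a finite cyclic quotient,
  and the kernel of this action is torsion-free, whereas the lamplighter group has involutions in the
  kernel of any of its actions on a finite set.
\<close>

section \<open>The lamplighter group\<close>

text \<open>Elements are described by the set of lit lamps and the shift, so that multiplication
  becomes translation followed by symmetric difference.\<close>

definition lamp :: "int set \<Rightarrow> int \<Rightarrow> (int \<Rightarrow> int) \<times> int" where
  "lamp U k = (\<lambda>i. of_bool (i \<in> U), k)"

lemma lamp_eq_iff [simp]: "lamp U k = lamp V l \<longleftrightarrow> U = V \<and> k = l"
  by (auto simp: lamp_def fun_eq_iff of_bool_eq_iff)

lemma carrier_lamplighter_group: "carrier lamplighter_group = {lamp U k |U k. finite U}"
proof -
  have carr: "carrier lamplighter_group = {(f, k). (\<forall>i. f i \<in> {0..<2}) \<and> finite {i. f i \<noteq> 0}}"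
    by (auto simp: lamplighter_group_def semidirect_product_def carrier_sum_group
        carrier_integer_mod_group integer_group_def PiE_iff)
  have "(f, k) = lamp {i. f i \<noteq> 0} k" if "\<forall>i. f i \<in> {0..<2}" for f k
  proof -
    have "f i = of_bool (f i \<noteq> 0)" for i
      using that[rule_format, of i] by auto
    then show ?thesis by (simp add: lamp_def fun_eq_iff)
  qed
  then have "u \<in> {lamp U k |U k. finite U}" if "u \<in> carrier lamplighter_group" for u
    using that by (cases u) (auto simp: carr)
  moreover have "lamp U k \<in> carrier lamplighter_group" if "finite U" for U k
    using that by (simp add: carr lamp_def)
  ultimately show ?thesis
    by (auto simp del: split_paired_All)
qed

lemma lamp_in_carrier [simp]: "lamp U k \<in> carrier lamplighter_group \<longleftrightarrow> finite U"
  by (auto simp: carrier_lamplighter_group)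

lemma mult_lamp [simp]:
  "lamp U k \<otimes>\<^bsub>lamplighter_group\<^esub> lamp V l = lamp (sym_diff U ((+) k ` V)) (k + l)"
proof -
  have "i - k \<in> V \<longleftrightarrow> i \<in> (+) k ` V" for i
    by (force simp: image_iff)
  then show ?thesis
    by (auto simp: lamplighter_group_def semidirect_product_def lamp_def fun_eq_iff)
qed

lemma one_lamplighter_group: "\<one>\<^bsub>lamplighter_group\<^esub> = lamp {} 0"
  by (simp add: lamplighter_group_def semidirect_product_def lamp_def fun_eq_iff)

lemma lamp_cases:
  assumes "u \<in> carrier lamplighter_group"
  obtains U k where "u = lamp U k" "finite U"
  using assms by (auto simp: carrier_lamplighter_group)

text \<open>Conjugating the lamp at 0 by powers of the shift gives the lamp at every position;
  finite products of these give every \<open>lamp U 0\<close>, and a final shift gives the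
  rest.\<close>

lemma lamplighter_group_generated:
  assumes K: "subgroup K lamplighter_group" and "lamp {0} 0 \<in> K" and 1: "lamp {} 1 \<in> K"
  shows "carrier lamplighter_group \<subseteq> K"
proof -
  interpret L: group lamplighter_group by (rule group_lamplighter_group)
  note mult = subgroup.m_closed[OF K]
  have "inv\<^bsub>lamplighter_group\<^esub> (lamp {} 1) = lamp {} (- 1)"
    by (rule L.inv_equality) (simp_all add: one_lamplighter_group)
  then have m1: "lamp {} (- 1) \<in> K"
    using subgroup.m_inv_closed[OF K 1] by simp
  have shift: "lamp {} k \<in> K" for k
  proof (induction k rule: int_induct[where k = 0])
    case base
    show ?case using subgroup.one_closed[OF K] by (simp add: one_lamplighter_group)
  next
    case (step1 i) then show ?case using mult[OF _ 1, of "lamp {} i"] by simp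
  next
    case (step2 i) then show ?case using mult[OF _ m1, of "lamp {} i"] by simp
  qed
  have single: "lamp {i} 0 \<in> K" for i
    using mult[OF mult[OF shift[of i] assms(2)] shift[of "- i"]] by simp
  have "lamp U 0 \<in> K" if "finite U" for U
    using that
  proof (induction U)
    case empty
    show ?case by (rule shift)
  next
    case (insert i U)
    have "sym_diff {i} U = insert i U" using insert by auto
    then show ?case using mult[OF single[of i] insert.IH] by simp
  qed
  then have "lamp U k \<in> K" if "finite U" for U k
    using mult[OF _ shift, of "lamp U 0" k] that by simp
  then show ?thesis
    by (auto simp: carrier_lamplighter_group)
qed

section \<open>Recognising a lamplighter group inside a group\<close>

lemma (in group) inv_mult_cancel_left:
  "\<lbrakk>a \<in> carrier G; b \<in> carrier G\<rbrakk> \<Longrightarrow> inv a \<otimes> (a \<otimes> b) = b"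
  by (simp flip: m_assoc)

text \<open>The hypotheses \<open>add\<close> and \<open>shift\<close> are the relations of the
  wreath product, with \<open>A U\<close> the product of the lamps in \<open>U\<close> and
  \<open>t\<close> the shift. That \<open>t\<close> has infinite order is derived from
  \<open>free\<close>.\<close>

lemma (in group) lamplighter_embedding:
  fixes A :: "int set \<Rightarrow> 'a"
  assumes P: "subgroup P G" and t: "t \<in> P" and A: "\<And>U. finite U \<Longrightarrow> A U \<in> P"
    and add: "\<And>U V. \<lbrakk>finite U; finite V\<rbrakk> \<Longrightarrow> A (sym_diff U V) = A U \<otimes> A V"
    and shift: "\<And>U. finite U \<Longrightarrow> t \<otimes> A U = A ((+) 1 ` U) \<otimes> t"
    and free: "\<And>U. \<lbrakk>finite U; A U = \<one>\<rbrakk> \<Longrightarrow> U = {}"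
  obtains \<Psi> where "\<Psi> \<in> hom lamplighter_group G" "inj_on \<Psi> (carrier lamplighter_group)"
    "\<Psi> ` carrier lamplighter_group \<subseteq> P"
proof
  let ?\<Psi> = "\<lambda>(f, k). A {i. f i \<noteq> (0::int)} \<otimes> t [^] (k::int)"
  have tG [simp]: "t \<in> carrier G" by (rule subgroup.mem_carrier[OF P t])
  have AG [simp]: "A U \<in> carrier G" if "finite U" for U
    by (rule subgroup.mem_carrier[OF P A[OF that]])
  have \<Psi>: "?\<Psi> (lamp U k) = A U \<otimes> t [^] k" for U k by (simp add: lamp_def)
  have lcancel: "b = c" if "a \<otimes> b = a \<otimes> c" "a \<in> carrier G" "b \<in> carrier G" "c \<in> carrier G" for a b c
    using that inv_mult_cancel_left by metis
  have shiftn: "t [^] n \<otimes> A U = A ((+) (int n) ` U) \<otimes> t [^] n" if "finite U" for n U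
  proof (induction n)
    case 0
    then show ?case using that by simp
  next
    case (Suc n)
    have "t [^] Suc n \<otimes> A U = t \<otimes> (t [^] n \<otimes> A U)"
      using that by (subst nat_pow_Suc2) (simp_all add: m_assoc)
    also have "\<dots> = (t \<otimes> A ((+) (int n) ` U)) \<otimes> t [^] n"
      using that Suc by (simp add: m_assoc)
    also have "\<dots> = A ((+) 1 ` ((+) (int n) ` U)) \<otimes> (t \<otimes> t [^] n)"
      using that shift[of "(+) (int n) ` U"] by (simp add: m_assoc)
    also have "(+) 1 ` ((+) (int n) ` U) = (+) (int (Suc n)) ` U"
      by (simp add: image_image algebra_simps)
    finally show ?case by (subst nat_pow_Suc2) simp_all
  qed
  have shiftz: "t [^] k \<otimes> A U = A ((+) k ` U) \<otimes> t [^] k" if "finite U" for k :: int and U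
  proof (cases "0 \<le> k")
    case True
    then show ?thesis using shiftn[OF that, of "nat k"] by (simp flip: int_pow_int)
  next
    case False
    define n where "n = nat (- k)"
    have k: "k = - int n" using False by (simp add: n_def)
    let ?s = "t [^] n"
    have "?s \<otimes> A ((+) k ` U) = A U \<otimes> ?s"
      using that shiftn[of "(+) k ` U" n] by (simp add: k image_image)
    then have "inv ?s \<otimes> (?s \<otimes> A ((+) k ` U)) \<otimes> inv ?s = inv ?s \<otimes> (A U \<otimes> ?s) \<otimes> inv ?s"
      by simp
    then have "A ((+) k ` U) \<otimes> inv ?s = inv ?s \<otimes> A U"
      using that by (simp add: m_assoc inv_mult_cancel_left)
    then show ?thesis by (simp add: k int_pow_neg_int)
  qed
  show hom: "?\<Psi> \<in> hom lamplighter_group G"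
  proof (rule homI)
    fix u assume "u \<in> carrier lamplighter_group"
    then show "?\<Psi> u \<in> carrier G" by (auto elim!: lamp_cases simp: \<Psi> simp del: split_paired_All)
  next
    fix u v assume "u \<in> carrier lamplighter_group" "v \<in> carrier lamplighter_group"
    then obtain U k V l where uv: "u = lamp U k" "finite U" "v = lamp V l" "finite V"
      by (auto elim!: lamp_cases)
    have "?\<Psi> (u \<otimes>\<^bsub>lamplighter_group\<^esub> v) = A U \<otimes> (A ((+) k ` V) \<otimes> t [^] k) \<otimes> t [^] l"
      using uv by (simp add: \<Psi> add int_pow_mult m_assoc)
    also have "\<dots> = A U \<otimes> t [^] k \<otimes> (A V \<otimes> t [^] l)"
      using uv by (simp add: m_assoc flip: shiftz)
    finally show "?\<Psi> (u \<otimes>\<^bsub>lamplighter_group\<^esub> v) = ?\<Psi> u \<otimes> ?\<Psi> v"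
      by (simp add: uv \<Psi>)
  qed
  interpret \<Psi>: group_hom lamplighter_group G ?\<Psi>
    using hom by (simp add: group_hom_def group_hom_axioms_def group_lamplighter_group is_group)
  show "inj_on ?\<Psi> (carrier lamplighter_group)"
  proof -
    have "u = \<one>\<^bsub>lamplighter_group\<^esub>"
      if uL: "u \<in> carrier lamplighter_group" and 1: "?\<Psi> u = \<one>" for u
    proof -
      obtain U k where u: "u = lamp U k" and U: "finite U" using uL by (rule lamp_cases)
      let ?s = "t [^] k"
      have "A {} \<otimes> A {} = A {} \<otimes> \<one>" using add[of "{}" "{}"] by simp
      then have A0: "A {} = \<one>" by (rule lcancel) simp_all
      have AA: "A U \<otimes> A U = \<one>" using add[OF U U] A0 by simp
      have "A U \<otimes> ?s = \<one>" using 1 by (simp only: u \<Psi>)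
      then have "A U \<otimes> ?s = A U \<otimes> A U" using AA by simp
      then have s: "?s = A U" by (rule lcancel) (simp_all add: U)
      \<comment> \<open>The power \<open>t [^] k\<close> equals \<open>A U\<close>, so it commutes
        with \<open>A {0}\<close>; but conjugation by it also sends \<open>A {0}\<close> to
        \<open>A {k}\<close>. Hence \<open>free\<close> forces \<open>k = 0\<close>.\<close>
      have "A ((+) k ` {0}) \<otimes> ?s = A (sym_diff U {0})"
        using shiftz[of "{0}" k] U s add[of U "{0}"] by simp
      also have "\<dots> = A {0} \<otimes> ?s"
        using s add[of "{0}" U] U by (simp add: Un_commute)
      finally have "A {k} = A {0}" by simp
      then have "A (sym_diff {k} {0}) = A (sym_diff {0} {0})"
        by (simp only: add finite.emptyI finite.insertI)
      then have "sym_diff {k} {0} = {}" using A0 by (intro free) auto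
      then have k: "k = 0" by auto
      then have "A U = \<one>" using s by simp
      then show ?thesis using free[OF U] k by (simp add: u one_lamplighter_group)
    qed
    then show ?thesis using \<Psi>.inj_on_one_iff by blast
  qed
  show "?\<Psi> ` carrier lamplighter_group \<subseteq> P"
  proof -
    have inP: "A U \<otimes> t [^] k \<in> P" if "finite U" for U and k :: int
      using subgroup.m_closed[OF P A[OF that] subgroup_int_pow_closed[OF P t]] .
    show ?thesis
    proof (rule image_subsetI)
      fix u assume "u \<in> carrier lamplighter_group"
      then obtain U k where "u = lamp U k" "finite U" by (rule lamp_cases)
      then show "?\<Psi> u \<in> P" using inP by (simp only: \<Psi>)
    qed
  qed
qed

section \<open>Copies of one group inside another\<close>

lemma contains_copy_ofI:
  assumes "group_hom L G \<Phi>" "inj_on \<Phi> (carrier L)"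
  shows "contains_copy_of G L"
  unfolding contains_copy_of_def
proof (intro exI conjI)
  show "subgroup (\<Phi> ` carrier L) G"
    using assms(1) by (rule group_hom.img_is_subgroup)
  have "\<Phi> \<in> hom L G" using assms(1) by (simp add: group_hom_def group_hom_axioms_def)
  then show "L \<cong> G\<lparr>carrier := \<Phi> ` carrier L\<rparr>"
    using assms(2) by (intro is_isoI isoI) (auto simp: hom_def bij_betw_def)
qed

lemma contains_copy_ofE:
  assumes "contains_copy_of G L"
  obtains \<Phi> where "\<Phi> \<in> hom L G" "inj_on \<Phi> (carrier L)"
proof -
  obtain H \<Phi> where H: "subgroup H G" and \<Phi>: "\<Phi> \<in> iso L (G\<lparr>carrier := H\<rparr>)"
    using assms by (auto simp: contains_copy_of_def is_iso_def)
  have "\<Phi> \<in> hom L G"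
    using \<Phi> subgroup.subset[OF H] by (auto simp: iso_def hom_def)
  then show thesis
    using \<Phi> by (auto simp: iso_def bij_betw_def intro: that)
qed

lemma (in group) group_commutator_subgroup:
  "subgroup (carrier (commutator_subgroup G)) G" "group (commutator_subgroup G)"
proof -
  show "subgroup (carrier (commutator_subgroup G)) G"
    by (simp add: commutator_subgroup_def derived_is_subgroup)
  then show "group (commutator_subgroup G)"
    using subgroup_imp_group by (simp add: commutator_subgroup_def)
qed

text \<open>
  Commutators with \<open>x\<close> are multiplicative on the two generators only up to inversion on the second
  factor; precomposing that factor with the automorphism inverting the shift repairs this.
\<close>

lemma (in group) commutator_subgroup_contains_lamplighter_group:
  assumes P: "subgroup P G" and x: "x \<in> carrier G"
    and \<Psi>: "\<Psi> \<in> hom lamplighter_group G" "inj_on \<Psi> (carrier lamplighter_group)"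
      "\<Psi> ` carrier lamplighter_group \<subseteq> P"
    and comm: "\<And>p q. \<lbrakk>p \<in> P; q \<in> P\<rbrakk> \<Longrightarrow> p \<otimes> (x \<otimes> q \<otimes> inv x) = x \<otimes> q \<otimes> inv x \<otimes> p"
    and triv: "\<And>p q. \<lbrakk>p \<in> P; q \<in> P; p \<otimes> (x \<otimes> q \<otimes> inv x) = \<one>\<rbrakk> \<Longrightarrow> p = \<one>"
  shows "contains_copy_of (commutator_subgroup G) lamplighter_group"
proof -
  let ?L = lamplighter_group
  let ?D = "derived G (carrier G)"
  interpret L: group ?L by (rule group_lamplighter_group)
  interpret \<Psi>: group_hom ?L G \<Psi>
    using \<Psi>(1) by (simp add: group_hom_def group_hom_axioms_def group_lamplighter_group is_group)
  \<comment> \<open>The automorphism that reflects the lamp positions in 0 and reverses the shift;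
    it inverts both generators \<open>lamp {0} 0\<close> and \<open>lamp {} 1\<close>.\<close>
  define \<theta> where "\<theta> = (\<lambda>(f, k). (\<lambda>i::int. f (- i) :: int, - k :: int))"
  have \<theta>: "\<theta> (lamp U k) = lamp (uminus ` U) (- k)" for U k
  proof -
    have "- i \<in> U \<longleftrightarrow> i \<in> uminus ` U" for i by (force simp: image_iff)
    then show ?thesis by (simp add: \<theta>_def lamp_def fun_eq_iff)
  qed
  have \<theta>_closed [simp]: "\<theta> u \<in> carrier ?L" if "u \<in> carrier ?L" for u
    using that by (auto elim!: lamp_cases simp: \<theta>)
  have \<theta>_mult: "\<theta> (u \<otimes>\<^bsub>?L\<^esub> v) = \<theta> u \<otimes>\<^bsub>?L\<^esub> \<theta> v"
    if uv: "u \<in> carrier ?L" "v \<in> carrier ?L" for u v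
  proof -
    have "uminus ` sym_diff U ((+) k ` V) = sym_diff (uminus ` U) ((+) (- k) ` uminus ` V)"
      for U V and k :: int
    proof -
      have "uminus ` sym_diff U ((+) k ` V) = sym_diff (uminus ` U) (uminus ` (+) k ` V)"
        by (simp add: image_Un image_set_diff)
      also have "uminus ` (+) k ` V = (+) (- k) ` uminus ` V"
        by (simp add: image_image algebra_simps)
      finally show ?thesis .
    qed
    with uv show ?thesis
      by (auto elim!: lamp_cases simp: \<theta>)
  qed
  have inP: "\<Psi> u \<in> P" if "u \<in> carrier ?L" for u using \<Psi>(3) that by blast
  \<comment> \<open>As \<open>\<theta>\<close> inverts the generators, on them \<open>\<Phi>\<close>
    is the commutator of \<open>\<Psi> u\<close> with \<open>x\<close>; \<open>comm\<close> makes it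
    multiplicative everywhere.\<close>
  define \<Phi> where "\<Phi> u = \<Psi> u \<otimes> (x \<otimes> \<Psi> (\<theta> u) \<otimes> inv x)" for u
  have hom: "\<Phi> \<in> hom ?L G"
  proof (rule homI)
    show "\<Phi> u \<in> carrier G" if "u \<in> carrier ?L" for u
      using that x by (simp add: \<Phi>_def)
  next
    fix u v assume uv: "u \<in> carrier ?L" "v \<in> carrier ?L"
    have "\<Phi> (u \<otimes>\<^bsub>?L\<^esub> v) = \<Psi> u \<otimes> (\<Psi> v \<otimes> (x \<otimes> \<Psi> (\<theta> u) \<otimes> inv x)) \<otimes> (x \<otimes> \<Psi> (\<theta> v) \<otimes> inv x)"
      using uv x by (simp add: \<Phi>_def \<theta>_mult m_assoc inv_mult_cancel_left)
    also have "\<dots> = \<Phi> u \<otimes> \<Phi> v"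
      using uv x comm[OF inP inP, of v "\<theta> u"] by (simp add: \<Phi>_def m_assoc)
    finally show "\<Phi> (u \<otimes>\<^bsub>?L\<^esub> v) = \<Phi> u \<otimes> \<Phi> v" .
  qed
  then interpret \<Phi>: group_hom ?L G \<Phi>
    by (simp add: group_hom_def group_hom_axioms_def group_lamplighter_group is_group)
  have inj: "inj_on \<Phi> (carrier ?L)"
    unfolding \<Phi>.inj_on_one_iff
  proof (intro allI impI)
    fix u assume u: "u \<in> carrier ?L" "\<Phi> u = \<one>"
    then have "\<Psi> u = \<one>" using triv[OF inP inP, of u "\<theta> u"] by (simp add: \<Phi>_def)
    then show "u = \<one>\<^bsub>?L\<^esub>" using \<Psi>(2) u(1) \<Psi>.inj_on_one_iff by blast
  qed
  have D: "subgroup ?D G" by (simp add: derived_is_subgroup)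
  have comD: "g \<otimes> x \<otimes> inv g \<otimes> inv x \<in> ?D" if "g \<in> carrier G" for g
    unfolding derived_def using that x by (intro generate.incl) blast
  \<comment> \<open>The elements that \<open>\<Phi>\<close> sends into the derived subgroup form a
    subgroup, so it suffices to test the two generators.\<close>
  have "subgroup {u \<in> carrier ?L. \<Phi> u \<in> ?D} ?L"
  proof (rule L.subgroupI)
    have "\<one>\<^bsub>?L\<^esub> \<in> {u \<in> carrier ?L. \<Phi> u \<in> ?D}"
      using subgroup.one_closed[OF D] by simp
    then show "{u \<in> carrier ?L. \<Phi> u \<in> ?D} \<noteq> {}" by blast
  qed (use D in \<open>auto intro: subgroup.m_closed subgroup.m_inv_closed\<close>)
  moreover have "\<Phi> (lamp {0} 0) \<in> ?D"
  proof -
    let ?a = "lamp {0} 0"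
    have "?a \<otimes>\<^bsub>?L\<^esub> ?a = \<one>\<^bsub>?L\<^esub>" by (simp add: one_lamplighter_group)
    then have "inv\<^bsub>?L\<^esub> ?a = ?a" by (intro L.inv_equality) auto
    then have "inv (\<Psi> ?a) = \<Psi> (\<theta> ?a)"
      using \<Psi>.hom_inv[of ?a] by (simp add: \<theta>)
    then show ?thesis
      using comD[of "\<Psi> ?a"] x by (simp add: \<Phi>_def m_assoc)
  qed
  moreover have "\<Phi> (lamp {} 1) \<in> ?D"
  proof -
    let ?a = "lamp {} 1"
    have "\<theta> ?a \<otimes>\<^bsub>?L\<^esub> ?a = \<one>\<^bsub>?L\<^esub>" by (simp add: one_lamplighter_group \<theta>)
    then have "inv\<^bsub>?L\<^esub> ?a = \<theta> ?a" by (intro L.inv_equality) auto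
    then have "inv (\<Psi> ?a) = \<Psi> (\<theta> ?a)"
      using \<Psi>.hom_inv[of ?a] by simp
    then show ?thesis
      using comD[of "\<Psi> ?a"] x by (simp add: \<Phi>_def m_assoc)
  qed
  ultimately have "carrier ?L \<subseteq> {u \<in> carrier ?L. \<Phi> u \<in> ?D}"
    by (intro lamplighter_group_generated) auto
  then have "\<Phi> \<in> hom ?L (commutator_subgroup G)"
    using hom by (auto simp: hom_def commutator_subgroup_def)
  then have "group_hom ?L (commutator_subgroup G) \<Phi>"
    by (simp add: group_hom_def group_hom_axioms_def group_lamplighter_group group_commutator_subgroup)
  then show ?thesis using inj by (rule contains_copy_ofI)
qed

section \<open>Linear recurrences over the field with two elements\<close>

text \<open>By \<open>det\<close> the map \<open>g\<close> induces an injective self-map of the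
  finite set of values of \<open>w\<close>, hence a permutation, some positive power of which is the
  identity.\<close>

lemma finite_image_period:
  assumes g: "bij_betw g B B" and fin: "finite (w ` B)"
    and det: "\<And>b c. \<lbrakk>b \<in> B; c \<in> B\<rbrakk> \<Longrightarrow> w (g b) = w (g c) \<longleftrightarrow> w b = w c"
  obtains p where "0 < p" "\<And>b. b \<in> B \<Longrightarrow> w ((g ^^ p) b) = w b"
proof -
  let ?W = "w ` B"
  define F where "F x = (if x \<in> ?W then w (g (inv_into B w x)) else x)" for x
  have gB: "g b \<in> B" if "b \<in> B" for b using g that by (rule bij_betwE[THEN bspec])
  have F: "F (w b) = w (g b)" if "b \<in> B" for b
  proof -
    have "inv_into B w (w b) \<in> B" "w (inv_into B w (w b)) = w b"
      using that by (simp_all add: inv_into_into f_inv_into_f)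
    then show ?thesis using det[of "inv_into B w (w b)" b] that by (simp add: F_def)
  qed
  have "inj_on F ?W" using F det by (auto simp: inj_on_def)
  moreover have "F ` ?W \<subseteq> ?W" using F gB by auto
  ultimately have "bij_betw F ?W ?W"
    using endo_inj_surj[OF fin] by (simp add: bij_betw_def)
  then have "F permutes ?W" by (rule bij_imp_permutes) (simp add: F_def)
  then have "permutation F" using fin permutation_permutes by blast
  then obtain p where p: "F ^^ p = id" "0 < p" by (rule permutation_is_nilpotent)
  have "(g ^^ k) b \<in> B \<and> w ((g ^^ k) b) = (F ^^ k) (w b)" if "b \<in> B" for k b
  proof (induction k)
    case (Suc k)
    then show ?case using F[of "(g ^^ k) b"] gB by simp
  qed (use that in simp)
  then show thesis using p by (intro that[of p]) auto
qed

lemma odd_card_remove: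
  assumes "finite V" "d \<in> V" "even (card {j \<in> V. P j})"
  shows "P d \<longleftrightarrow> odd (card {j \<in> V - {d}. P j})"
proof (cases "P d")
  case True
  then have "{j \<in> V. P j} = insert d {j \<in> V - {d}. P j}" using assms by auto
  then show ?thesis using assms True by simp
next
  case False
  then have "{j \<in> V. P j} = {j \<in> V - {d}. P j}" by auto
  then show ?thesis using assms False by simp
qed

lemma odd_card_sym_diff:
  assumes "finite U" "finite V"
  shows "odd (card (sym_diff U V)) \<longleftrightarrow> (odd (card U) \<noteq> odd (card V))"
proof -
  have "card (sym_diff U V) = card (U - V) + card (V - U)"
    using assms by (intro card_Un_disjoint) auto
  moreover have "card U = card (U - V) + card (U \<inter> V)"
    using assms by (subst card_Un_disjoint[symmetric]) (auto intro: arg_cong[where f = card])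
  moreover have "card V = card (V - U) + card (U \<inter> V)"
    using assms by (subst card_Un_disjoint[symmetric]) (auto intro: arg_cong[where f = card])
  ultimately show ?thesis by auto
qed

text \<open>
  The hypothesis is a linear recurrence over the field with two elements whose extreme coefficients
  are nonzero, so that a window of fixed length determines both neighbouring windows.
\<close>

lemma linear_recurrence_period:
  assumes g: "bij_betw g B B" and U: "finite U" "U \<noteq> {}"
    and even: "\<And>b. b \<in> B \<Longrightarrow> even (card {i \<in> U. int_iterate B g (- i) b \<in> E})"
  obtains p where "0 < p" "\<And>b. b \<in> B \<Longrightarrow> (g ^^ p) b \<in> E \<longleftrightarrow> b \<in> E"
proof -
  let ?M = "Max U"
  \<comment> \<open>Adding \<open>Max U\<close> to the exponents \<open>- i\<close> makes them
    natural numbers; 0 is then one of them and \<open>d\<close> is the largest.\<close>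
  define V where "V = (\<lambda>i. nat (?M - i)) ` U"
  define d where "d = Max V"
  have V: "finite V" "V \<noteq> {}" using U by (auto simp: V_def)
  have "nat (?M - ?M) \<in> V" unfolding V_def using Max_in[OF U] by (rule imageI)
  then have V0: "0 \<in> V" by simp
  have Vd: "d \<in> V" "\<And>j. j \<in> V \<Longrightarrow> j \<le> d" using V by (auto simp: d_def)
  have evenV: "even (card {j \<in> V. (g ^^ j) b \<in> E})" if b: "b \<in> B" for b
  proof -
    have iter: "int_iterate B g (- i) (int_iterate B g ?M b) = (g ^^ nat (?M - i)) b" if "i \<in> U" for i
      using that U int_iterate_add[OF g b, of "- i" ?M] by (simp add: int_iterate_def)
    have "{j \<in> V. (g ^^ j) b \<in> E} = (\<lambda>i. nat (?M - i)) ` {i \<in> U. int_iterate B g (- i) (int_iterate B g ?M b) \<in> E}"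
      using iter by (auto simp: V_def)
    moreover have "inj_on (\<lambda>i. nat (?M - i)) U"
      using U Max_ge[of U] by (force intro!: inj_onI simp: eq_nat_nat_iff)
    then have "inj_on (\<lambda>i. nat (?M - i)) {i \<in> U. int_iterate B g (- i) (int_iterate B g ?M b) \<in> E}"
      by (rule inj_on_subset) auto
    ultimately show ?thesis
      using even[OF int_iterate_closed[OF g b, of ?M]] by (simp add: card_image)
  qed
  have gB: "g b \<in> B" if "b \<in> B" for b using g that by (rule bij_betwE[THEN bspec])
  \<comment> \<open>The window of \<open>b\<close>: the times up to \<open>d\<close> at which its
    orbit is in \<open>E\<close>. Only finitely many windows are possible.\<close>
  define w where "w b = {j \<in> {..d}. (g ^^ j) b \<in> E}" for b
  have step: "w (g b) = {j \<in> {..d}. (g ^^ Suc j) b \<in> E}" for b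
    by (simp add: w_def funpow_swap1)
  \<comment> \<open>The relation at \<open>g b\<close>, solved for its term with exponent
    \<open>d\<close>, extends the window of \<open>b\<close> one step forward.\<close>
  have last: "(g ^^ Suc d) b \<in> E \<longleftrightarrow> odd (card {j \<in> V - {d}. Suc j \<in> w b})" if "b \<in> B" for b
  proof -
    have "{j \<in> V - {d}. Suc j \<in> w b} = {j \<in> V - {d}. (g ^^ j) (g b) \<in> E}"
      using Vd by (auto simp: w_def funpow_swap1 Suc_le_eq less_le)
    then show ?thesis
      using odd_card_remove[OF V(1) Vd(1) evenV[OF gB[OF that]]] by (simp add: funpow_swap1)
  qed
  \<comment> \<open>The relation at \<open>b\<close>, solved for its term with exponent 0, extends
    the window of \<open>g b\<close> one step backward.\<close>
  have first: "b \<in> E \<longleftrightarrow> odd (card {j \<in> V - {0}. j - 1 \<in> w (g b)})" if "b \<in> B" for b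
  proof -
    have "{j \<in> V - {0}. j - 1 \<in> w (g b)} = {j \<in> V - {0}. (g ^^ j) b \<in> E}"
    proof (intro Collect_cong conj_cong refl)
      fix j assume "j \<in> V - {0}"
      then obtain i where "j = Suc i" "i \<le> d" using Vd(2)[of j] by (cases j) auto
      then show "j - 1 \<in> w (g b) \<longleftrightarrow> (g ^^ j) b \<in> E" by (simp add: step)
    qed
    then show ?thesis
      using odd_card_remove[OF V(1) V0 evenV[OF that]] by simp
  qed
  have det: "w (g b) = w (g c) \<longleftrightarrow> w b = w c" if bc: "b \<in> B" "c \<in> B" for b c
  proof
    assume eq: "w b = w c"
    have "(g ^^ Suc j) b \<in> E \<longleftrightarrow> (g ^^ Suc j) c \<in> E" if "j \<le> d" for j
    proof (cases "j = d")
      case True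
      then show ?thesis using last[OF bc(1)] last[OF bc(2)] eq by simp
    next
      case False
      then have "Suc j \<in> w b \<longleftrightarrow> Suc j \<in> w c" "Suc j \<le> d" using eq that by simp_all
      then show ?thesis by (simp add: w_def)
    qed
    then show "w (g b) = w (g c)" unfolding step by auto
  next
    assume eq: "w (g b) = w (g c)"
    have "(g ^^ j) b \<in> E \<longleftrightarrow> (g ^^ j) c \<in> E" if "j \<le> d" for j
    proof (cases j)
      case 0
      then show ?thesis using first[OF bc(1)] first[OF bc(2)] eq by simp
    next
      case (Suc i)
      then have "i \<in> w (g b) \<longleftrightarrow> i \<in> w (g c)" "i \<le> d" using eq that by simp_all
      then show ?thesis unfolding step Suc by simp
    qed
    then show "w b = w c" by (auto simp: w_def)
  qed
  have "w ` B \<subseteq> Pow {..d}" by (auto simp: w_def)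
  then have fin: "finite (w ` B)" by (rule finite_subset) simp
  obtain p where p: "0 < p" "\<And>b. b \<in> B \<Longrightarrow> w ((g ^^ p) b) = w b"
    using finite_image_period[OF g fin det] by blast
  moreover have "b \<in> E \<longleftrightarrow> 0 \<in> w b" for b by (simp add: w_def)
  ultimately show thesis by (intro that[of p]) auto
qed

lemma int_iterate_invariant:
  assumes g: "bij_betw g B B" and inv: "\<And>b. b \<in> B \<Longrightarrow> P (g b) \<longleftrightarrow> P b" and b: "b \<in> B"
  shows "P (int_iterate B g k b) \<longleftrightarrow> P b"
proof (induction k rule: int_induct[where k = 0])
  case base
  show ?case by simp
next
  case (step1 i)
  then show ?case using int_iterate_step[OF g b, of i] inv[OF int_iterate_closed[OF g b]] by simp
next
  case (step2 i)
  then show ?case using int_iterate_step[OF g b, of "i - 1"] inv[OF int_iterate_closed[OF g b]] by simp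
qed

lemma funpow_mult_invariant:
  assumes "g ` B \<subseteq> B" "\<And>b. b \<in> B \<Longrightarrow> f ((g ^^ p) b) = f b" "b \<in> B"
  shows "f ((g ^^ (k * p)) b) = f b"
proof (induction k)
  case (Suc k)
  have "(g ^^ n) b \<in> B" for n using assms(1,3) by (induction n) auto
  then show ?case using Suc assms(2)[of "(g ^^ (k * p)) b"] by (simp add: funpow_add)
qed simp

section \<open>Locally constant functions\<close>

text \<open>Equivalent to continuity into a discrete space. Clopen sets \<open>C\<close> are treated
  throughout as locally constant predicates \<open>\<lambda>x. x \<in> C\<close>, so that sets,
  return times and cocycles share one calculus.\<close>

definition loc_const :: "'a topology \<Rightarrow> ('a \<Rightarrow> 'b) \<Rightarrow> bool" where
  "loc_const X f \<longleftrightarrow>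
    (\<forall>x\<in>topspace X. \<exists>U. openin X U \<and> x \<in> U \<and> (\<forall>y\<in>U. f x = f y))"

lemma loc_const_iff_continuous_map:
  "loc_const X f \<longleftrightarrow> continuous_map X (discrete_topology UNIV) f"
proof
  assume f: "loc_const X f"
  have "openin X {x \<in> topspace X. f x \<in> U}" for U
  proof (subst openin_subopen, intro ballI)
    fix x assume x: "x \<in> {x \<in> topspace X. f x \<in> U}"
    then obtain V where "openin X V" "x \<in> V" "\<forall>y\<in>V. f x = f y"
      using f by (auto simp: loc_const_def)
    then show "\<exists>T. openin X T \<and> x \<in> T \<and> T \<subseteq> {x \<in> topspace X. f x \<in> U}"
      using x openin_subset by (intro exI[of _ V]) fastforce
  qed
  then show "continuous_map X (discrete_topology UNIV) f"
    by (simp add: continuous_map_def)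
next
  assume f: "continuous_map X (discrete_topology UNIV) f"
  show "loc_const X f"
    unfolding loc_const_def
  proof
    fix x assume "x \<in> topspace X"
    then show "\<exists>U. openin X U \<and> x \<in> U \<and> (\<forall>y\<in>U. f x = f y)"
      using openin_continuous_map_preimage[OF f, of "{f x}"]
      by (intro exI[of _ "{y \<in> topspace X. f y \<in> {f x}}"]) simp
  qed
qed

lemma loc_const_openin:
  assumes "loc_const X f"
  shows "openin X {x \<in> topspace X. P (f x)}"
  using openin_continuous_map_preimage[of X "discrete_topology UNIV" f "{y. P y}"] assms
  by (simp add: loc_const_iff_continuous_map)

lemma loc_const_closedin:
  assumes "loc_const X f"
  shows "closedin X {x \<in> topspace X. P (f x)}"
  using closedin_continuous_map_preimage[of X "discrete_topology UNIV" f "{y. P y}"] assms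
  by (simp add: loc_const_iff_continuous_map)

lemma loc_const_mem:
  assumes "openin X C" "closedin X C"
  shows "loc_const X (\<lambda>x. x \<in> C)"
  unfolding loc_const_def
proof
  fix x assume x: "x \<in> topspace X"
  show "\<exists>U. openin X U \<and> x \<in> U \<and> (\<forall>y\<in>U. (x \<in> C) = (y \<in> C))"
  proof (cases "x \<in> C")
    case True
    then show ?thesis using assms by (intro exI[of _ C]) auto
  next
    case False
    then show ?thesis using assms x by (intro exI[of _ "topspace X - C"]) auto
  qed
qed

lemma loc_const_const [simp]: "loc_const X (\<lambda>_. a)"
  by (auto simp: loc_const_def)

text \<open>A neighbourhood on which \<open>f\<close> is constant is one on which \<open>h\<close>
  is constant. Many clopen sets below are obtained by letting \<open>f\<close> collect finitely many
  pieces of data.\<close>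

lemma loc_const_factor:
  assumes "loc_const X f" "\<And>x y. \<lbrakk>x \<in> topspace X; y \<in> topspace X; f x = f y\<rbrakk> \<Longrightarrow> h x = h y"
  shows "loc_const X h"
  unfolding loc_const_def
proof
  fix x assume x: "x \<in> topspace X"
  then obtain V where "openin X V" "x \<in> V" "\<forall>y\<in>V. f x = f y"
    using assms(1) unfolding loc_const_def by blast
  note V = this
  have "h x = h y" if "y \<in> V" for y
  proof (rule assms(2)[OF x])
    show "y \<in> topspace X" using that openin_subset[OF V(1)] by blast
    show "f x = f y" using that V(3) by blast
  qed
  then show "\<exists>U. openin X U \<and> x \<in> U \<and> (\<forall>y\<in>U. h x = h y)"
    using V by blast
qed

lemma loc_const_comp: "loc_const X f \<Longrightarrow> loc_const X (\<lambda>x. h (f x))"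
  by (erule loc_const_factor) simp

lemma loc_const_pair:
  assumes "loc_const X f" "loc_const X g"
  shows "loc_const X (\<lambda>x. (f x, g x))"
  unfolding loc_const_def
proof
  fix x assume x: "x \<in> topspace X"
  obtain V where "openin X V" "x \<in> V" "\<forall>y\<in>V. f x = f y"
    using assms(1) x by (auto simp: loc_const_def)
  moreover obtain W where "openin X W" "x \<in> W" "\<forall>y\<in>W. g x = g y"
    using assms(2) x by (auto simp: loc_const_def)
  ultimately have "openin X (V \<inter> W) \<and> x \<in> V \<inter> W \<and> (\<forall>y\<in>V \<inter> W. (f x, g x) = (f y, g y))"
    by blast
  then show "\<exists>U. openin X U \<and> x \<in> U \<and> (\<forall>y\<in>U. (f x, g x) = (f y, g y))" by blast
qed

lemma loc_const_comp2:
  assumes "loc_const X f" "loc_const X g"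
  shows "loc_const X (\<lambda>x. h (f x) (g x))"
  using loc_const_comp[OF loc_const_pair[OF assms], of "\<lambda>(a, b). h a b"] by simp

lemma loc_const_if:
  assumes "loc_const X P" "loc_const X f" "loc_const X g"
  shows "loc_const X (\<lambda>x. if P x then f x else g x)"
  by (rule loc_const_factor[OF loc_const_pair[OF assms(1) loc_const_pair[OF assms(2,3)]]]) simp

lemma loc_const_finite_family:
  assumes "finite I" "\<And>i. i \<in> I \<Longrightarrow> loc_const X (f i)"
  shows "loc_const X (\<lambda>x. {i \<in> I. f i x})"
  using assms
proof (induction I)
  case empty
  then show ?case by simp
next
  case (insert j I)
  have "loc_const X (\<lambda>x. ({i \<in> I. f i x}, f j x))"
    using insert by (intro loc_const_pair) auto
  then show ?case by (rule loc_const_factor) auto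
qed

lemma loc_const_compose_map:
  assumes "continuous_map X X h" "loc_const X f"
  shows "loc_const X (\<lambda>x. f (h x))"
  using continuous_map_compose[OF assms(1), of "discrete_topology UNIV" f] assms(2)
  by (simp add: loc_const_iff_continuous_map o_def)

lemma loc_const_finite_image:
  assumes "compact_space X" "loc_const X f"
  shows "finite (f ` topspace X)"
proof -
  have "compactin (discrete_topology UNIV) (f ` topspace X)"
    using assms image_compactin[of X "topspace X"]
    by (auto simp: loc_const_iff_continuous_map compact_space_def)
  then show ?thesis by (simp add: compactin_discrete_topology)
qed

lemma continuous_map_int_iterate:
  assumes f: "homeomorphic_map X X f"
  shows "continuous_map X X (int_iterate (topspace X) f n)"
proof -
  have pow: "continuous_map X X (h ^^ k)" if "continuous_map X X h" for h k
  proof (induction k)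
    case 0
    show ?case by (simp add: id_def)
  next
    case (Suc k)
    then show ?case using continuous_map_compose[OF Suc that] by (simp add: o_def)
  qed
  have "continuous_map X X (inv_into (topspace X) f)"
  proof -
    obtain g where g: "homeomorphic_maps X X f g" using f homeomorphic_map_maps by blast
    have "g x = inv_into (topspace X) f x" if "x \<in> topspace X" for x
    proof -
      have "g x \<in> topspace X" "f (g x) = x"
        using g that by (auto simp: homeomorphic_maps_def continuous_map_def)
      then show ?thesis
        using inv_into_f_f[OF homeomorphic_imp_injective_map[OF f], of "g x"] by simp
    qed
    then show ?thesis
      using g continuous_map_eq[of X X g] by (auto simp: homeomorphic_maps_def)
  qed
  then show ?thesis
    using pow homeomorphic_imp_continuous_map[OF f] by (auto simp: int_iterate_def)
qed

section \<open>Cantor minimal systems\<close>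

text \<open>Positivity of the moduli matters, since \<open>integer_mod_group 0\<close> has all
  integers as its carrier.\<close>

lemma topspace_odometer_space:
  assumes "odometer_type m"
  shows "topspace (odometer_space m) = {y. \<forall>n. y n \<in> {0..<int (m n)} \<and> y (Suc n) mod int (m n) = y n}"
proof -
  have "carrier (integer_mod_group (m n)) = {0..<int (m n)}" for n
    using assms by (auto simp: odometer_type_def carrier_integer_mod_group)
  then show ?thesis
    by (auto simp: odometer_space_def PiE_iff)
qed

locale cantor_minimal =
  fixes X :: "'a topology" and \<phi> :: "'a \<Rightarrow> 'a"
  assumes cantor_minimal: "cantor_minimal_system X \<phi>"
begin

abbreviation "S \<equiv> topspace X"
abbreviation "it \<equiv> int_iterate S \<phi>"

lemma nonempty: "S \<noteq> {}" and compact: "compact_space X" and metrizable: "metrizable_space X"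
  and totally_disconnected: "\<And>C. connectedin X C \<Longrightarrow> \<exists>a. C \<subseteq> {a}"
  and perfect: "\<And>x. x \<in> S \<Longrightarrow> \<not> openin X {x}"
  and homeo: "homeomorphic_map X X \<phi>"
  and dense: "\<And>x. x \<in> S \<Longrightarrow> X closure_of (range (\<lambda>n. it n x)) = S"
  using cantor_minimal by (auto simp: cantor_minimal_system_def cantor_space_def)

lemma Hausdorff: "Hausdorff_space X"
  by (rule metrizable_imp_Hausdorff_space[OF metrizable])

lemma bij: "bij_betw \<phi> S S"
  using homeo by (simp add: bij_betw_def homeomorphic_imp_injective_map homeomorphic_imp_surjective_map)

lemmas it_closed [simp] = int_iterate_closed[OF bij]
lemmas it_add = int_iterate_add[OF bij]

lemma it_it [simp]: "x \<in> S \<Longrightarrow> it m (it n x) = it (m + n) x"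
  by (simp add: it_add)

lemma it_1: "it 1 x = \<phi> x"
  by (simp add: int_iterate_def)

lemma continuous_it: "continuous_map X X (it n)"
  by (rule continuous_map_int_iterate[OF homeo])

lemma loc_const_it: "loc_const X f \<Longrightarrow> loc_const X (\<lambda>x. f (it n x))"
  by (rule loc_const_compose_map[OF continuous_it])

section \<open>Dense and free orbits\<close>

lemma orbit_meets:
  assumes "openin X U" "U \<noteq> {}" "x \<in> S"
  obtains n where "it n x \<in> U"
proof -
  obtain y where y: "y \<in> U" using assms(2) by blast
  then have "y \<in> X closure_of (range (\<lambda>n. it n x))"
    using dense[OF assms(3)] openin_subset[OF assms(1)] by blast
  then have "\<exists>z. z \<in> range (\<lambda>n. it n x) \<and> z \<in> U"
    using y assms(1) unfolding in_closure_of by blast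
  then show thesis using that by blast
qed

lemma orbit_meets_loc_const:
  assumes "loc_const X f" "x \<in> S" "y \<in> S"
  obtains n where "f (it n x) = f y"
proof -
  obtain n where "it n x \<in> {z \<in> S. f z = f y}"
    by (rule orbit_meets[OF loc_const_openin[OF assms(1), of "\<lambda>a. a = f y"] _ assms(2)])
      (use assms(3) in blast)
  then show thesis using that by blast
qed

text \<open>A periodic point would have a finite orbit, which is closed and dense, hence the whole
  space; but points of a finite Hausdorff space are isolated.\<close>

lemma aperiodic:
  assumes x: "x \<in> S" and "it n x = x"
  shows "n = 0"
proof (rule ccontr)
  assume n: "n \<noteq> 0"
  have per: "it (m * n) x = x" for m
  proof (induction m rule: int_induct[where k = 0])
    case base
    then show ?case by simp
  next
    case (step1 i)
    then show ?case using it_it[OF x, of n "i * n"] assms(2) by (simp add: algebra_simps)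
  next
    case (step2 i)
    have "it ((i - 1) * n) x = it (- n) (it (i * n) x)" using x by (simp add: algebra_simps)
    also have "\<dots> = it (- n) (it n x)" using step2 assms(2) by (simp del: it_it)
    finally show ?case using x by simp
  qed
  have "it k x \<in> (\<lambda>k. it k x) ` {0..<\<bar>n\<bar>}" for k
  proof -
    have "it (k div \<bar>n\<bar> * \<bar>n\<bar>) x = x"
      using per[of "k div \<bar>n\<bar> * sgn n"] by (simp add: mult.assoc linordered_idom_class.abs_sgn mult.commute)
    then have "it k x = it (k mod \<bar>n\<bar>) x"
      using it_add[OF x, of "k mod \<bar>n\<bar>" "k div \<bar>n\<bar> * \<bar>n\<bar>"] by simp
    then show ?thesis using n by simp
  qed
  then have fin: "finite (range (\<lambda>k. it k x))"
    by (meson finite_atLeastLessThan_int finite_imageI finite_subset image_subsetI)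
  have "closedin X (range (\<lambda>k. it k x))"
    using fin x by (intro closedin_Hausdorff_finite[OF Hausdorff]) auto
  then have "range (\<lambda>k. it k x) = S"
    using dense[OF x] closure_of_closedin[of X "range (\<lambda>k. it k x)"] by simp
  then have "finite S" using fin by simp
  then have "closedin X (S - {x})"
    using closedin_Hausdorff_finite[OF Hausdorff, of "S - {x}"] by simp
  then have "openin X {x}"
    using x by (simp add: closedin_def double_diff)
  then show False using perfect[OF x] by blast
qed

lemma it_eq_iff [simp]: "x \<in> S \<Longrightarrow> it m x = it n x \<longleftrightarrow> m = n"
proof
  assume x: "x \<in> S" and eq: "it m x = it n x"
  have "it (m - n) x = it (- n) (it m x)" using x by simp
  also have "\<dots> = it (- n) (it n x)" by (simp only: eq)
  also have "\<dots> = x" using x by simp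
  finally show "m = n" using aperiodic[OF x, of "m - n"] by simp
qed simp

section \<open>Clopen sets separating points\<close>

lemma clopen_base:
  assumes U: "openin X U" "x \<in> U"
  obtains C where "C \<subseteq> U" "x \<in> C" "loc_const X (\<lambda>y. y \<in> C)"
proof -
  have x: "x \<in> S" using U openin_subset by blast
  let ?Q = "quasi_component_of_set X x"
  have Q: "?Q \<in> quasi_components_of X"
    using x by (simp add: quasi_components_of_def)
  \<comment> \<open>In a compact Hausdorff space quasi-components are components, here single
    points; so a clopen set separates \<open>x\<close> from the compact complement of
    \<open>U\<close>.\<close>
  have "?Q \<in> connected_components_of X"
    using quasi_eq_connected_components_of[of X] compact Hausdorff Q by simp
  then have "\<exists>a. ?Q \<subseteq> {a}"
    by (intro totally_disconnected connectedin_connected_components_of)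
  then have Qx: "?Q = {x}" using x by (metis (mono_tags) mem_Collect_eq quasi_component_of_refl subset_singleton_iff singletonD empty_iff insertE)
  have "compactin X (S - U)"
    using U by (intro closedin_compact_space[OF compact]) auto
  then have "separated_between X {x} (S - U)"
    using separated_between_quasi_component_compact[OF Q] Qx U by (simp add: disjnt_def)
  then obtain A D where A: "openin X A" "openin X D" "A \<union> D = S" "disjnt A D" "{x} \<subseteq> A" "S - U \<subseteq> D"
    unfolding separated_between_def by blast
  have "A = S - D" using A(3,4) by (auto simp: disjnt_iff)
  then have "closedin X A" using A(2) openin_closedin_eq[of X D] closedin_diff[of X S D] by auto
  moreover have "A \<subseteq> U" using A(3,4,6) by (auto simp: disjnt_iff)
  ultimately show thesis using A(1,5) loc_const_mem[of X A] by (intro that[of A]) auto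
qed

lemma separation:
  assumes "x \<in> S" "y \<in> S" "x \<noteq> y"
  obtains C where "C \<subseteq> S" "loc_const X (\<lambda>z. z \<in> C)" "x \<in> C" "y \<notin> C"
proof -
  obtain U V where "openin X U" "x \<in> U" "y \<in> V" "disjnt U V"
    using Hausdorff assms unfolding Hausdorff_space_def by blast
  note UV = this
  obtain C where C: "C \<subseteq> U" "x \<in> C" "loc_const X (\<lambda>y. y \<in> C)"
    using clopen_base[OF UV(1,2)] .
  show thesis
  proof (rule that[OF _ C(3,2)])
    show "C \<subseteq> S" using C(1) openin_subset[OF UV(1)] by (rule order_trans)
    show "y \<notin> C" using C(1) UV(3,4) by (auto simp: disjnt_iff)
  qed
qed

text \<open>For each \<open>n\<close> the space is covered by finitely many clopen sets inside balls
  of radius \<open>inverse (real (Suc n))\<close>; together these sets are countable and separate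
  points.\<close>

lemma countable_separation:
  obtains C :: "nat \<Rightarrow> 'a set" where "\<And>n. loc_const X (\<lambda>z. z \<in> C n)"
    "\<And>x y. \<lbrakk>x \<in> S; y \<in> S; x \<noteq> y\<rbrakk> \<Longrightarrow> \<exists>n. x \<in> C n \<and> y \<notin> C n"
proof -
  obtain M d where M: "Metric_space M d" and X: "X = Metric_space.mtopology M d"
    using metrizable unfolding metrizable_space_def by blast
  interpret Metric_space M d by (rule M)
  have S: "S = M" by (simp add: X)
  have "\<exists>F. finite F \<and> S \<subseteq> \<Union>F \<and>
      (\<forall>C\<in>F. loc_const X (\<lambda>z. z \<in> C) \<and> (\<exists>x. C \<subseteq> mball x (inverse (real (Suc n)))))" for n
  proof -
    let ?\<U> = "{C. openin X C \<and> loc_const X (\<lambda>z. z \<in> C) \<and> (\<exists>x. C \<subseteq> mball x (inverse (real (Suc n))))}"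
    have "S \<subseteq> \<Union>?\<U>"
    proof
      fix x assume x: "x \<in> S"
      let ?B = "mball x (inverse (real (Suc n)))"
      have B: "openin X ?B" "x \<in> ?B" using x by (simp_all add: X)
      then obtain C where C: "C \<subseteq> ?B" "x \<in> C" "loc_const X (\<lambda>y. y \<in> C)"
        using clopen_base by metis
      moreover have "C = {y \<in> S. y \<in> C}" using C(1) openin_subset[OF B(1)] by blast
      then have "openin X C" using loc_const_openin[OF C(3), of "\<lambda>b. b"] by simp
      ultimately show "x \<in> \<Union>?\<U>" by blast
    qed
    then obtain F where "finite F" "F \<subseteq> ?\<U>" "S \<subseteq> \<Union>F"
      using compact[unfolded compact_space_alt, rule_format, of ?\<U>] by blast
    then show ?thesis by blast
  qed
  then obtain F where F: "\<And>n. finite (F n)" "\<And>n. S \<subseteq> \<Union>(F n)"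
    "\<And>n C. C \<in> F n \<Longrightarrow> loc_const X (\<lambda>z. z \<in> C)"
    "\<And>n C. C \<in> F n \<Longrightarrow> \<exists>x. C \<subseteq> mball x (inverse (real (Suc n)))"
    by metis
  have sep: "\<exists>C\<in>(\<Union>n. F n). x \<in> C \<and> y \<notin> C" if xy: "x \<in> S" "y \<in> S" "x \<noteq> y" for x y
  proof -
    have "0 < d x y / 2" using xy S by simp
    then obtain n where n: "inverse (real (Suc n)) < d x y / 2"
      using reals_Archimedean by blast
    obtain C z where C: "C \<in> F n" "x \<in> C" and z: "C \<subseteq> mball z (inverse (real (Suc n)))"
      using F(2)[of n] F(4)[of _ n] xy by blast
    have "y \<notin> C"
    proof
      assume "y \<in> C"
      then have "d z x < d x y / 2" "d z y < d x y / 2" "z \<in> M"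
        using C z n by (auto simp: subset_iff)
      then show False using triangle[of x z y] commute[of x z] xy S by simp
    qed
    then show ?thesis using C by blast
  qed
  have cnt: "countable (\<Union>n. F n)" using F(1) countable_finite by blast
  have ne: "(\<Union>n. F n) \<noteq> {}" using F(2) nonempty by fastforce
  show thesis
  proof (rule that[of "from_nat_into (\<Union>n. F n)"])
    show "loc_const X (\<lambda>z. z \<in> from_nat_into (\<Union>n. F n) k)" for k
      using from_nat_into[OF ne, of k] F(3) by blast
    show "\<exists>k. x \<in> from_nat_into (\<Union>n. F n) k \<and> y \<notin> from_nat_into (\<Union>n. F n) k"
      if "x \<in> S" "y \<in> S" "x \<noteq> y" for x y
      using sep[OF that] from_nat_into_surj[OF cnt] by metis
  qed
qed

subsection \<open>Elements of the topological full group\<close>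

abbreviation "G \<equiv> full_group X \<phi>"

lemma group_G: "group G"
  by (rule group_full_group[OF homeo])

text \<open>On each level set of \<open>c\<close> the map is a fixed iterate of \<phi>, so it is
  continuous; a continuous bijection of a compact Hausdorff space is a homeomorphism. Restriction
  gives the extensional representative.\<close>

lemma full_group_memI:
  assumes "loc_const X c" "bij_betw f S S" "\<And>x. x \<in> S \<Longrightarrow> f x = it (c x) x"
  shows "restrict f S \<in> carrier G"
proof -
  have bij: "bij_betw (restrict f S) S S"
    by (rule bij_betw_cong[THEN iffD1, OF _ assms(2)]) simp
  have "continuous_map X X (restrict f S)"
    unfolding continuous_map_def
  proof (intro conjI allI impI)
    show "restrict f S \<in> S \<rightarrow> S" using assms(2) by (auto simp: bij_betw_def)
    fix U assume U: "openin X U"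
    have "{x \<in> S. restrict f S x \<in> U} = (\<Union>k. {x \<in> S. c x = k} \<inter> {x \<in> S. it k x \<in> U})"
      using assms(3) by auto
    moreover have "openin X ({x \<in> S. c x = k} \<inter> {x \<in> S. it k x \<in> U})" for k
      using loc_const_openin[OF assms(1), of "\<lambda>a. a = k"]
        openin_continuous_map_preimage[OF continuous_it U, of k] by (rule openin_Int)
    ultimately show "openin X {x \<in> S. restrict f S x \<in> U}" by auto
  qed
  then have "homeomorphic_map X X (restrict f S)"
    using compact Hausdorff bij by (intro continuous_imp_homeomorphic_map) (auto simp: bij_betw_def)
  then show ?thesis
    using assms(1,3) bij by (auto simp: full_group_def Bij_def loc_const_iff_continuous_map)
qed

lemma G_carrier:
  assumes "u \<in> carrier G"
  shows "u \<in> Bij S" "bij_betw u S S" "homeomorphic_map X X u"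
    "\<exists>c. loc_const X c \<and> (\<forall>x\<in>S. u x = it (c x) x)"
  using assms by (auto simp: full_group_def Bij_def loc_const_iff_continuous_map)

lemma G_closed: "\<lbrakk>u \<in> carrier G; x \<in> S\<rbrakk> \<Longrightarrow> u x \<in> S"
  using G_carrier(2) bij_betwE by blast

lemma G_mult: "\<lbrakk>u \<in> carrier G; v \<in> carrier G; x \<in> S\<rbrakk> \<Longrightarrow> (u \<otimes>\<^bsub>G\<^esub> v) x = u (v x)"
  using G_carrier(1)[of u] G_carrier(1)[of v] by (simp add: full_group_def BijGroup_def compose_def)

lemma G_one: "x \<in> S \<Longrightarrow> \<one>\<^bsub>G\<^esub> x = x"
  by (simp add: full_group_def BijGroup_def)

lemma G_eqI: "\<lbrakk>u \<in> carrier G; v \<in> carrier G; \<And>x. x \<in> S \<Longrightarrow> u x = v x\<rbrakk> \<Longrightarrow> u = v"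
  using G_carrier(1)[of u] G_carrier(1)[of v] by (auto simp: Bij_def intro: extensionalityI)

lemma G_inv: "\<lbrakk>u \<in> carrier G; x \<in> S\<rbrakk> \<Longrightarrow> (inv\<^bsub>G\<^esub> u) (u x) = x"
  "\<lbrakk>u \<in> carrier G; x \<in> S\<rbrakk> \<Longrightarrow> u ((inv\<^bsub>G\<^esub> u) x) = x"
  using group.inv_closed[OF group_G] group.l_inv[OF group_G] group.r_inv[OF group_G] G_mult G_one
  by metis+

lemma G_inj: "\<lbrakk>u \<in> carrier G; x \<in> S; y \<in> S; u x = u y\<rbrakk> \<Longrightarrow> x = y"
  by (metis G_inv(1))

section \<open>Elements supported in a set\<close>

definition supported :: "'a set \<Rightarrow> ('a \<Rightarrow> 'a) set" where
  "supported Y = {u \<in> carrier G. \<forall>x\<in>S - Y. u x = x}"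

lemma subgroup_supported: "subgroup (supported Y) G"
proof -
  interpret group G by (rule group_G)
  show ?thesis
  proof (rule subgroupI)
    have "\<one>\<^bsub>G\<^esub> \<in> supported Y" by (auto simp: supported_def G_one)
    then show "supported Y \<noteq> {}" by blast
    show "inv\<^bsub>G\<^esub> u \<in> supported Y" if "u \<in> supported Y" for u
      using that G_inv(1)[of u] by (fastforce simp: supported_def)
    show "u \<otimes>\<^bsub>G\<^esub> v \<in> supported Y" if "u \<in> supported Y" "v \<in> supported Y" for u v
      using that by (auto simp: supported_def G_mult)
  qed (auto simp: supported_def)
qed

lemma supported_preserves:
  assumes "u \<in> supported Y" "z \<in> S" shows "u z \<in> Y \<longleftrightarrow> z \<in> Y"
proof -
  have u: "u \<in> carrier G" "\<And>x. x \<in> S - Y \<Longrightarrow> u x = x" using assms(1) by (auto simp: supported_def)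
  have "u z \<in> S" using G_closed u assms by blast
  show ?thesis
  proof (cases "z \<in> Y")
    case True
    have "u z = z" if "u z \<notin> Y"
      using that u(2)[of "u z"] \<open>u z \<in> S\<close> G_inj[OF u(1) \<open>u z \<in> S\<close> assms(2)] by blast
    then show ?thesis using True by metis
  next
    case False
    then show ?thesis using u(2)[of z] assms(2) by simp
  qed
qed

text \<open>Each of \<open>p\<close> and \<open>q\<close> preserves its own set and is the identity
  on the other. The conclusions supply \<open>comm\<close> and \<open>triv\<close> of
  \<open>commutator_subgroup_contains_lamplighter_group\<close>.\<close>

lemma supported_disjoint:
  assumes "Y \<inter> Z = {}" "p \<in> supported Y" "q \<in> supported Z"
  shows "p \<otimes>\<^bsub>G\<^esub> q = q \<otimes>\<^bsub>G\<^esub> p" "p \<otimes>\<^bsub>G\<^esub> q = \<one>\<^bsub>G\<^esub> \<Longrightarrow> p = \<one>\<^bsub>G\<^esub>"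
proof -
  interpret group G by (rule group_G)
  have p: "p \<in> carrier G" "\<And>x. x \<in> S - Y \<Longrightarrow> p x = x" using assms(2) by (auto simp: supported_def)
  have q: "q \<in> carrier G" "\<And>x. x \<in> S - Z \<Longrightarrow> q x = x" using assms(3) by (auto simp: supported_def)
  have pY: "q (p z) = p z" "q z = z" if "z \<in> S" "z \<in> Y" for z
    using that assms q(2)[of "p z"] q(2)[of z] supported_preserves[OF assms(2), of z] G_closed[OF p(1)]
    by auto
  have qZ: "p (q z) = q z" "p z = z" if "z \<in> S" "z \<notin> Y" for z
  proof -
    show "p z = z" using that p(2) by simp
    show "p (q z) = q z"
    proof (cases "z \<in> Z")
      case True
      then have "q z \<in> S - Y"
        using that assms(1) supported_preserves[OF assms(3), of z] G_closed[OF q(1)] by auto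
      then show ?thesis by (rule p(2))
    next
      case False
      then show ?thesis using that q(2)[of z] p(2)[of z] by simp
    qed
  qed
  have "(p \<otimes>\<^bsub>G\<^esub> q) z = (q \<otimes>\<^bsub>G\<^esub> p) z" if "z \<in> S" for z
    using that pY[of z] qZ[of z] p q by (cases "z \<in> Y") (simp_all add: G_mult)
  then show "p \<otimes>\<^bsub>G\<^esub> q = q \<otimes>\<^bsub>G\<^esub> p"
    using p q by (intro G_eqI) auto
  assume 1: "p \<otimes>\<^bsub>G\<^esub> q = \<one>\<^bsub>G\<^esub>"
  have "p z = \<one>\<^bsub>G\<^esub> z" if "z \<in> S" for z
  proof (cases "z \<in> Y")
    case True
    then show ?thesis using pY[of z] that G_mult[OF p(1) q(1), of z] 1 by simp
  next
    case False
    then show ?thesis using that p(2) by (simp add: G_one)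
  qed
  then show "p = \<one>\<^bsub>G\<^esub>" using p by (intro G_eqI) auto
qed

lemma supported_conj:
  assumes "x \<in> carrier G" "q \<in> supported Y"
  shows "x \<otimes>\<^bsub>G\<^esub> q \<otimes>\<^bsub>G\<^esub> inv\<^bsub>G\<^esub> x \<in> supported (x ` (Y \<inter> S))"
proof -
  interpret group G by (rule group_G)
  have q: "q \<in> carrier G" "\<And>x. x \<in> S - Y \<Longrightarrow> q x = x" using assms(2) by (auto simp: supported_def)
  have "(x \<otimes>\<^bsub>G\<^esub> q \<otimes>\<^bsub>G\<^esub> inv\<^bsub>G\<^esub> x) z = z" if z: "z \<in> S" "z \<notin> x ` (Y \<inter> S)" for z
  proof -
    have i: "(inv\<^bsub>G\<^esub> x) z \<in> S" "x ((inv\<^bsub>G\<^esub> x) z) = z"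
      using assms z G_closed[of "inv\<^bsub>G\<^esub> x" z] G_inv(2)[of x z] by auto
    then have "(inv\<^bsub>G\<^esub> x) z \<in> S - Y" using z(2) by force
    then show ?thesis using i q assms(1) z by (simp add: G_mult G_closed)
  qed
  then show ?thesis using assms(1) q(1) by (auto simp: supported_def)
qed

subsection \<open>Exchanging a clopen set with a translate\<close>

text \<open>Meant for \<open>Y\<close> disjoint from its image under \<open>it k\<close>; then it is
  an involution with displacements \<open>k\<close>, \<open>- k\<close> and 0.\<close>

definition exchange :: "int \<Rightarrow> 'a set \<Rightarrow> 'a \<Rightarrow> 'a" where
  "exchange k Y x = (if x \<in> Y then it k x else if it (- k) x \<in> Y then it (- k) x else x)"

lemma exchange_in_G:
  assumes Y: "Y \<subseteq> S" "loc_const X (\<lambda>x. x \<in> Y)" and disj: "\<And>y. y \<in> Y \<Longrightarrow> it k y \<notin> Y"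
  shows "restrict (exchange k Y) S \<in> carrier G"
proof (rule full_group_memI)
  let ?c = "\<lambda>x. if x \<in> Y then k else if it (- k) x \<in> Y then - k else 0"
  show "loc_const X ?c"
    by (intro loc_const_if loc_const_it[of "\<lambda>x. x \<in> Y"] Y(2) loc_const_const)
  show "exchange k Y x = it (?c x) x" for x by (simp add: exchange_def)
  have "exchange k Y (exchange k Y x) = x" if "x \<in> S" for x
    using that disj by (simp add: exchange_def)
  then show "bij_betw (exchange k Y) S S"
    by (intro bij_betw_byWitness[where f' = "exchange k Y"]) (auto simp: exchange_def)
qed

text \<open>Lamps and shift both live on \<open>Y\<close>, the union of \<open>B\<close> and its
  image under \<phi>. A trivial product of lamps would be a linear recurrence for \<open>E\<close>,
  against \<open>np\<close>; the disjoint translates of \<open>B\<close> leave room for a second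
  copy of \<open>Y\<close>.\<close>

lemma commutator_subgroup_contains_lamplighter_group_if_aperiodic:
  fixes r :: "'a \<Rightarrow> int"
  defines "g \<equiv> \<lambda>b. it (r b) b"
  assumes B: "B \<subseteq> S" "loc_const X (\<lambda>x. x \<in> B)"
    and disj: "\<And>b j. \<lbrakk>b \<in> B; j \<in> {1, 2, 3}\<rbrakk> \<Longrightarrow> it j b \<notin> B"
    and r: "loc_const X r" and g: "bij_betw g B B"
    and E: "E \<subseteq> B" "loc_const X (\<lambda>x. x \<in> E)"
    and np: "\<And>p. 0 < p \<Longrightarrow> \<exists>b\<in>B. (g ^^ p) b \<in> E \<longleftrightarrow> b \<notin> E"
  shows "contains_copy_of (commutator_subgroup G) lamplighter_group"
proof -
  interpret G: group G by (rule group_G)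
  define Y where "Y = {x \<in> S. x \<in> B \<or> it (- 1) x \<in> B}"
  \<comment> \<open>Acting by \<open>h\<close> on \<open>B\<close> and by its conjugate on the image
    of \<open>B\<close> keeps each \<open>b\<close> paired with \<open>it 1 b\<close>, so
    \<open>T\<close> conjugates exchanges into exchanges.\<close>
  define lift where "lift h x = (if x \<in> B then h x else if it (- 1) x \<in> B then it 1 (h (it (- 1) x)) else x)"
    for h :: "'a \<Rightarrow> 'a" and x
  define T where "T = lift g"
  have BS [simp]: "b \<in> S" if "b \<in> B" for b using that B(1) by blast
  have disj1: "it 1 b \<notin> B" "it (- 1) b \<notin> B" if "b \<in> B" for b
    using disj[OF that, of 1] disj[of "it (- 1) b" 1] that by auto
  have B_cases: "x \<in> B \<or> (\<exists>b\<in>B. x = it 1 b) \<or> x \<notin> B \<and> it (- 1) x \<notin> B" if "x \<in> S" for x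
  proof -
    have "x = it 1 (it (- 1) x)" using that by simp
    then show ?thesis by blast
  qed
  have lift: "lift h b = h b" "lift h (it 1 b) = it 1 (h b)" if "b \<in> B" for h b
    using that disj1 by (simp_all add: lift_def)
  have lift_id: "lift h x = x" if "x \<notin> B" "it (- 1) x \<notin> B" for h x
    using that by (simp add: lift_def)
  have gB: "g b \<in> B" if "b \<in> B" for b using g that by (rule bij_betwE[THEN bspec])
  have lift_S: "lift h x \<in> S" if "x \<in> S" "\<And>b. b \<in> B \<Longrightarrow> h b \<in> B" for h x
    using that by (simp add: lift_def)
  have lift_inv: "lift h (lift h' x) = x"
    if "x \<in> S" "\<And>b. b \<in> B \<Longrightarrow> h' b \<in> B" "\<And>b. b \<in> B \<Longrightarrow> h (h' b) = b" for h h' x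
    using B_cases[OF that(1)] that(2,3) by (auto simp: lift lift_id)
  let ?h = "inv_into B g"
  have h: "?h b \<in> B" "g (?h b) = b" "?h (g b) = b" if "b \<in> B" for b
    using that g bij_betwE[OF bij_betw_inv_into[OF g]]
    by (simp_all add: bij_betw_inv_into_right bij_betw_inv_into_left)
  have T_bij: "bij_betw T S S"
    by (intro bij_betw_byWitness[where f' = "lift ?h"])
      (use lift_inv[where h = ?h and h' = g] lift_inv[where h = g and h' = ?h] lift_S[where h = g] lift_S[where h = ?h] h gB
        in \<open>auto simp: T_def\<close>)
  have T: "T b = g b" "T (it 1 b) = it 1 (g b)" if "b \<in> B" for b
    using that lift by (simp_all add: T_def)
  have T_id: "T x = x" if "x \<notin> B" "it (- 1) x \<notin> B" for x
    using that lift_id by (simp add: T_def)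
  have TG: "restrict T S \<in> carrier G"
  proof (rule full_group_memI[OF _ T_bij])
    let ?c = "\<lambda>x. if x \<in> B then r x else if it (- 1) x \<in> B then r (it (- 1) x) else 0"
    show "loc_const X ?c"
      by (intro loc_const_if loc_const_it[of "\<lambda>x. x \<in> B"] loc_const_it[of r] B(2) r loc_const_const)
    show "T x = it (?c x) x" if "x \<in> S" for x
      using that by (simp add: T_def lift_def g_def)
  qed
  have T_supp: "restrict T S \<in> supported Y"
    using TG T_id by (auto simp: supported_def Y_def)
  have T_homeo: "homeomorphic_map X X T"
    using G_carrier(3)[OF TG] by (rule homeomorphic_map_eq) simp
  let ?Tz = "int_iterate S T"
  have T_B: "T x \<in> B \<longleftrightarrow> x \<in> B" if "x \<in> S" for x
    using B_cases[OF that] gB disj1 by (auto simp: T T_id)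
  have Tz_B: "?Tz k x \<in> B \<longleftrightarrow> x \<in> B" if "x \<in> S" for k x
    by (rule int_iterate_invariant[OF T_bij _ that, of "\<lambda>x. x \<in> B"]) (rule T_B)
  \<comment> \<open>The symmetric difference of the images of \<open>E\<close> under the powers of
    \<open>T\<close> with exponents in \<open>U\<close>: a point counts if it lies in an odd number
    of them.\<close>
  define EU where "EU U = {x \<in> S. odd (card {i \<in> U. ?Tz (- i) x \<in> E})}" for U
  have EU_B: "EU U \<subseteq> B" for U
  proof
    fix x assume x: "x \<in> EU U"
    then have "{i \<in> U. ?Tz (- i) x \<in> E} \<noteq> {}"
      by (metis (no_types, lifting) EU_def card.empty even_zero mem_Collect_eq)
    then show "x \<in> B" using x E(1) Tz_B by (auto simp: EU_def)
  qed
  have EU_lc: "loc_const X (\<lambda>x. x \<in> EU U)" if "finite U" for U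
  proof (rule loc_const_factor)
    show "loc_const X (\<lambda>x. {i \<in> U. ?Tz (- i) x \<in> E})"
      by (rule loc_const_finite_family[OF that])
        (rule loc_const_compose_map[OF continuous_map_int_iterate[OF T_homeo] E(2)])
  qed (simp add: EU_def)
  have EU_shift: "T b \<in> EU ((+) 1 ` U) \<longleftrightarrow> b \<in> EU U" if b: "b \<in> S" for b U
  proof -
    have Ti: "?Tz (- (1 + i)) (T b) = ?Tz (- i) b" for i
      using int_iterate_add[OF T_bij b, of "- (1 + i)" 1] by (simp add: int_iterate_def[of _ _ 1])
    have "{j \<in> (+) 1 ` U. ?Tz (- j) (T b) \<in> E} = (+) 1 ` {i \<in> U. ?Tz (- i) b \<in> E}"
      using Ti by auto
    then show ?thesis
      using b bij_betwE[OF T_bij] by (simp add: EU_def card_image)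
  qed
  have EU_sym_diff: "x \<in> EU (sym_diff U V) \<longleftrightarrow> (x \<in> EU U) \<noteq> (x \<in> EU V)"
    if "finite U" "finite V" "x \<in> S" for U V x
  proof -
    have "{i \<in> sym_diff U V. ?Tz (- i) x \<in> E} =
        sym_diff {i \<in> U. ?Tz (- i) x \<in> E} {i \<in> V. ?Tz (- i) x \<in> E}" by auto
    then show ?thesis
      using that odd_card_sym_diff[of "{i \<in> U. ?Tz (- i) x \<in> E}" "{i \<in> V. ?Tz (- i) x \<in> E}"]
      by (simp add: EU_def)
  qed
  \<comment> \<open>The product of the lamps at the positions in \<open>U\<close>, where the lamp at
    \<open>i\<close> exchanges the image of \<open>E\<close> under the \<open>i\<close>-th power of
    \<open>T\<close> with its translate by \<phi>.\<close>
  define A where "A U = restrict (exchange 1 (EU U)) S" for U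
  have A: "A U b = (if b \<in> EU U then it 1 b else b)" "A U (it 1 b) = (if b \<in> EU U then b else it 1 b)"
    if "b \<in> B" for U b
    using that EU_B[of U] disj1[OF that] by (auto simp: A_def exchange_def)
  have A_id: "A U x = x" if "x \<in> S" "x \<notin> B" "it (- 1) x \<notin> B" for U x
    using that EU_B[of U] by (auto simp: A_def exchange_def)
  have A_supp: "A U \<in> supported Y" if "finite U" for U
  proof -
    have "A U \<in> carrier G"
      unfolding A_def using EU_B[of U] disj1 by (intro exchange_in_G EU_lc[OF that]) auto
    then show ?thesis using A_id by (auto simp: supported_def Y_def)
  qed
  have AG: "A U \<in> carrier G" if "finite U" for U using A_supp[OF that] by (simp add: supported_def)
  have add: "A (sym_diff U V) = A U \<otimes>\<^bsub>G\<^esub> A V" if "finite U" "finite V" for U V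
  proof (rule G_eqI)
    fix x assume x: "x \<in> S"
    show "A (sym_diff U V) x = (A U \<otimes>\<^bsub>G\<^esub> A V) x"
      using B_cases[OF x] EU_sym_diff[OF that] that x
      by (auto simp: G_mult AG A A_id)
  qed (use that AG in auto)
  have shift: "restrict T S \<otimes>\<^bsub>G\<^esub> A U = A ((+) 1 ` U) \<otimes>\<^bsub>G\<^esub> restrict T S" if "finite U" for U
  proof (rule G_eqI)
    fix x assume x: "x \<in> S"
    show "(restrict T S \<otimes>\<^bsub>G\<^esub> A U) x = (A ((+) 1 ` U) \<otimes>\<^bsub>G\<^esub> restrict T S) x"
      using B_cases[OF x] that gB x EU_shift[OF BS, of _ U]
      by (auto simp: G_mult AG TG A A_id T T_id split: if_splits)
  qed (use that AG TG in auto)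
  \<comment> \<open>A trivial exchange has \<open>EU U\<close> empty, as \<phi> fixes no point. The
    parity is then even everywhere, and the linear recurrence gives \<open>E\<close> a
    period.\<close>
  have free: "U = {}" if U: "finite U" "A U = \<one>\<^bsub>G\<^esub>" for U
  proof (rule ccontr)
    assume ne: "U \<noteq> {}"
    have "EU U = {}"
    proof (rule ccontr)
      assume "EU U \<noteq> {}"
      then obtain b where b: "b \<in> EU U" "b \<in> B" using EU_B by blast
      then have "it 1 b = it 0 b" using A(1)[of b U] U(2) G_one[of b] by simp
      then show False using b by (subst (asm) it_eq_iff) simp_all
    qed
    then have even: "even (card {i \<in> U. ?Tz (- i) x \<in> E})" if "x \<in> S" for x
      using that by (auto simp: EU_def)
    obtain p where p: "0 < p" "\<And>x. x \<in> S \<Longrightarrow> (T ^^ p) x \<in> E \<longleftrightarrow> x \<in> E"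
      using linear_recurrence_period[OF T_bij U(1) ne even] by blast
    obtain b where b: "b \<in> B" "(g ^^ p) b \<in> E \<longleftrightarrow> b \<notin> E" using np[OF p(1)] by blast
    have "(T ^^ n) b = (g ^^ n) b \<and> (g ^^ n) b \<in> B" if "b \<in> B" for n b
      using that by (induction n) (auto simp: T gB)
    then show False using b p(2)[OF BS[OF b(1)]] by simp
  qed
  obtain \<Psi> where \<Psi>: "\<Psi> \<in> hom lamplighter_group G" "inj_on \<Psi> (carrier lamplighter_group)"
    "\<Psi> ` carrier lamplighter_group \<subseteq> supported Y"
    using G.lamplighter_embedding[OF subgroup_supported T_supp A_supp add shift free] by blast
  let ?x = "restrict (exchange 2 Y) S"
  \<comment> \<open>Points of \<open>Y\<close> have the form \<open>b\<close> or
    \<open>it 1 b\<close> with \<open>b\<close> in \<open>B\<close>, so only the differences 1, 2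
    and 3 of \<open>disj\<close> arise.\<close>
  have Y2: "it 2 y \<notin> Y" if "y \<in> Y" for y
  proof -
    have y: "y \<in> S" "y \<in> B \<or> it (- 1) y \<in> B" using that by (auto simp: Y_def)
    show ?thesis
    proof (cases "y \<in> B")
      case True
      then show ?thesis using disj[of y 2] disj[of y 1] by (simp add: Y_def)
    next
      case False
      then have b: "it (- 1) y \<in> B" using y(2) by blast
      show ?thesis using disj[OF b, of 3] disj[OF b, of 2] y(1) by (simp add: Y_def)
    qed
  qed
  have xG: "?x \<in> carrier G"
  proof (rule exchange_in_G)
    show "Y \<subseteq> S" by (auto simp: Y_def)
    show "loc_const X (\<lambda>x. x \<in> Y)"
      by (rule loc_const_factor[OF loc_const_pair[OF B(2) loc_const_it[OF B(2), of "- 1"]]])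
        (auto simp: Y_def)
  qed (rule Y2)
  have "?x ` (Y \<inter> S) \<inter> Y = {}" using Y2 by (auto simp: exchange_def)
  then have dis: "Y \<inter> ?x ` (Y \<inter> S) = {}" by (simp add: Int_commute)
  show ?thesis
    using supported_disjoint[OF dis _ supported_conj[OF xG]]
    by (intro G.commutator_subgroup_contains_lamplighter_group[OF subgroup_supported xG \<Psi>])
qed

subsection \<open>First return maps\<close>

text \<open>By minimality the sets of points that are in \<open>B\<close> after \<open>k\<close>
  steps form an open cover, and compactness bounds \<open>k\<close>.\<close>

lemma syndetic:
  assumes "loc_const X (\<lambda>x. x \<in> B)" "b \<in> B" "b \<in> S"
  obtains M :: nat where "\<And>x. x \<in> S \<Longrightarrow> \<exists>k. \<bar>k\<bar> \<le> int M \<and> it k x \<in> B"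
proof -
  let ?U = "\<lambda>k. {x \<in> S. it k x \<in> B}"
  have op: "openin X (?U k)" for k
    by (rule loc_const_openin[OF loc_const_it[OF assms(1)], of "\<lambda>a. a"])
  have "S \<subseteq> \<Union>(range ?U)"
  proof
    fix x assume x: "x \<in> S"
    obtain n where "(it n x \<in> B) = (b \<in> B)"
      using orbit_meets_loc_const[OF assms(1) x assms(3)] by metis
    then show "x \<in> \<Union>(range ?U)" using x assms(2) by auto
  qed
  then obtain F where "finite F" "F \<subseteq> range ?U" and cover: "S \<subseteq> \<Union>F"
    using compact[unfolded compact_space_alt, rule_format, of "range ?U"] op by blast
  then obtain K where K: "finite K" "F = ?U ` K" by (meson finite_subset_image)
  define M where "M = nat (Max (insert 0 (abs ` K)))"
  have "\<bar>k\<bar> \<le> int M" if "k \<in> K" for k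
  proof -
    have "\<bar>k\<bar> \<le> Max (insert 0 (abs ` K))" using that K(1) by (intro Max_ge) auto
    then show ?thesis unfolding M_def by linarith
  qed
  then show thesis using cover K by (intro that[of M]) blast
qed

text \<open>Gaps between visits to \<open>B\<close> are bounded, so the return time is the minimum
  of a set of times in a fixed finite range, and this set is locally constant in the point.\<close>

lemma first_return:
  assumes B: "B \<subseteq> S" "loc_const X (\<lambda>x. x \<in> B)" "B \<noteq> {}"
  obtains r :: "'a \<Rightarrow> int" where "loc_const X r" "\<And>b. b \<in> B \<Longrightarrow> 0 < r b"
    "bij_betw (\<lambda>b. it (r b) b) B B"
proof -
  obtain M :: nat where M: "\<And>x. x \<in> S \<Longrightarrow> \<exists>k. \<bar>k\<bar> \<le> int M \<and> it k x \<in> B"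
    using syndetic[OF B(2)] B(1,3) by (metis ex_in_conv subsetD)
  \<comment> \<open>Moving \<open>M + 1\<close> steps ahead and correcting by at most
    \<open>M\<close> steps gives a visit at a positive time not above
    \<open>2 * M + 1\<close>.\<close>
  define N where "N = 2 * M + 1"
  have forward: "\<exists>n\<in>{1..N}. it (int n) x \<in> B" if x: "x \<in> S" for x
  proof -
    obtain k where k: "\<bar>k\<bar> \<le> int M" "it k (it (int M + 1) x) \<in> B"
      using M x it_closed by blast
    define n where "n = nat (k + int M + 1)"
    have n: "n \<in> {1..N}" "int n = k + (int M + 1)" using k(1) by (auto simp: n_def N_def)
    then have "it (int n) x \<in> B" using k(2) x by simp
    then show ?thesis using n(1) by blast
  qed
  have backward: "\<exists>n>0. it (- int n) x \<in> B" if x: "x \<in> S" for x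
  proof -
    obtain k where k: "\<bar>k\<bar> \<le> int M" "it k (it (- (int M + 1)) x) \<in> B"
      using M x it_closed by blast
    define n where "n = nat (int M + 1 - k)"
    have n: "0 < n" "- int n = k + - (int M + 1)" using k(1) by (auto simp: n_def)
    then have "it (- int n) x \<in> B" using k(2) x by (simp del: minus_add_distrib)
    then show ?thesis using n(1) by blast
  qed
  define A where "A x = {n \<in> {1..N}. it (int n) x \<in> B}" for x
  define r where "r x = Min (A x)" for x
  have A: "finite (A x)" for x by (simp add: A_def)
  have ne: "A x \<noteq> {}" if "x \<in> S" for x using forward[OF that] by (auto simp: A_def)
  have r: "0 < r x" "r x \<le> N" "it (int (r x)) x \<in> B" if "x \<in> S" for x
    using Min_in[OF A ne[OF that]] by (auto simp: r_def A_def)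
  have r_min: "r x \<le> n" if "x \<in> S" "0 < n" "it (int n) x \<in> B" for x n
  proof (cases "n \<le> N")
    case True
    then have "n \<in> A x" using that by (simp add: A_def)
    then show ?thesis using A by (simp add: r_def)
  next
    case False
    then show ?thesis using r(2)[OF that(1)] by simp
  qed
  have "loc_const X A"
    unfolding A_def by (intro loc_const_finite_family loc_const_it[OF B(2)]) simp
  then have lc: "loc_const X (\<lambda>x. int (r x))"
    unfolding r_def by (rule loc_const_comp)
  let ?g = "\<lambda>b. it (int (r b)) b"
  have BS: "b \<in> S" if "b \<in> B" for b using that B(1) by blast
  \<comment> \<open>If distinct \<open>b\<close> and \<open>c\<close> had the same image,
    \<open>b\<close> would be a visit of the orbit of \<open>c\<close> to \<open>B\<close> before
    its first return.\<close>
  have inj: "b = c" if bc: "b \<in> B" "c \<in> B" "?g b = ?g c" "r b \<le> r c" for b c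
  proof (rule ccontr)
    assume "b \<noteq> c"
    have "it (- int (r b)) (?g b) = it (- int (r b)) (?g c)" using bc(3) by simp
    then have b: "b = it (int (r c - r b)) c" using bc(4) BS[OF bc(1)] BS[OF bc(2)] by (simp add: of_nat_diff)
    then have "0 < r c - r b" using \<open>b \<noteq> c\<close> by (cases "r c - r b") auto
    then have "r c \<le> r c - r b" using b bc(1) by (intro r_min BS[OF bc(2)]) auto
    then show False using r(1)[OF BS[OF bc(1)]] r(1)[OF BS[OF bc(2)]] by simp
  qed
  have "inj_on ?g B"
    by (rule inj_onI) (metis inj nle_le)
  moreover have "b \<in> ?g ` B" if b: "b \<in> B" for b
  proof -
    \<comment> \<open>The preimage of \<open>b\<close> is the most recent earlier visit of its orbit
      to \<open>B\<close>.\<close>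
    let ?n = "LEAST n. 0 < n \<and> it (- int n) b \<in> B"
    let ?c = "it (- int ?n) b"
    have n: "0 < ?n" "?c \<in> B"
      using LeastI_ex[OF backward[OF BS[OF b], folded Bex_def]] LeastI_ex[OF backward[OF BS[OF b]]] by auto
    have "r ?c = ?n"
    proof (rule antisym)
      show "r ?c \<le> ?n" using n b BS[OF b] by (intro r_min) auto
      show "?n \<le> r ?c"
      proof (rule ccontr)
        assume less: "\<not> ?n \<le> r ?c"
        then have "it (- int (?n - r ?c)) b \<in> B"
          using r(3)[of ?c] BS[OF b] by (simp add: of_nat_diff add.commute)
        then have "?n \<le> ?n - r ?c" using less by (intro Least_le) simp
        then show False using less r(1)[of ?c] BS[OF b] by simp
      qed
    qed
    then have "?g ?c = b" using BS[OF b] by simp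
    then show ?thesis using n(2) by (intro image_eqI[where x = ?c]) auto
  qed
  ultimately have "bij_betw ?g B B"
    using r(3) BS by (auto simp: bij_betw_def)
  then show thesis using lc r(1) BS by (intro that[of "\<lambda>x. int (r x)"]) auto
qed

text \<open>Every point is within \<open>M\<close> steps of \<open>B\<close>. If
  \<open>g ^^ p\<close> preserves both the return times and the pattern of \<open>C\<close> within
  \<open>M\<close> steps, then membership in \<open>C\<close> repeats with a period
  \<open>R p b\<close> depending on \<open>b\<close>; these periods are bounded and have a common
  multiple.\<close>

lemma periodic_if_return_map_periodic:
  fixes r :: "'a \<Rightarrow> int"
  defines "g \<equiv> \<lambda>b. it (r b) b"
  assumes B: "B \<subseteq> S" "loc_const X (\<lambda>x. x \<in> B)" "B \<noteq> {}"
    and r: "loc_const X r" "\<And>b. b \<in> B \<Longrightarrow> 0 < r b" and g: "g ` B \<subseteq> B"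
    and per: "\<And>E. \<lbrakk>E \<subseteq> B; loc_const X (\<lambda>x. x \<in> E)\<rbrakk> \<Longrightarrow> \<exists>p>0. \<forall>b\<in>B. (g ^^ p) b \<in> E \<longleftrightarrow> b \<in> E"
    and C: "loc_const X (\<lambda>x. x \<in> C)"
  shows "\<exists>Q>0. \<forall>x\<in>S. it (int Q) x \<in> C \<longleftrightarrow> x \<in> C"
proof -
  have gB: "(g ^^ n) b \<in> B" if "b \<in> B" for n b using g that by (induction n) auto
  have BS: "b \<in> S" if "b \<in> B" for b using that B(1) by blast
  \<comment> \<open>A locally constant function has finitely many values, and the product of the
    periods of its level sets is a period of the function.\<close>
  have period: "\<exists>p>0. \<forall>b\<in>B. f ((g ^^ p) b) = f b" if f: "loc_const X f" for f :: "'a \<Rightarrow> int \<times> int set"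
  proof -
    have "\<exists>p>0. \<forall>b\<in>B. f ((g ^^ p) b) = v \<longleftrightarrow> f b = v" for v
    proof -
      let ?E = "{b \<in> B. f b = v}"
      have "loc_const X (\<lambda>x. x \<in> ?E)"
        by (rule loc_const_factor[OF loc_const_pair[OF B(2) f]]) simp
      then obtain p where p: "0 < p" "\<forall>b\<in>B. (g ^^ p) b \<in> ?E \<longleftrightarrow> b \<in> ?E"
        using per[of ?E] by blast
      have "f ((g ^^ p) b) = v \<longleftrightarrow> f b = v" if "b \<in> B" for b
        using p(2)[rule_format, OF that] that gB[OF that, of p] by simp
      then show ?thesis using p(1) by blast
    qed
    then have "\<forall>v. \<exists>p. 0 < p \<and> (\<forall>b\<in>B. f ((g ^^ p) b) = v \<longleftrightarrow> f b = v)" by blast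
    from choice[OF this] obtain P where P: "\<And>v. 0 < P v"
      "\<And>v b. b \<in> B \<Longrightarrow> f ((g ^^ P v) b) = v \<longleftrightarrow> f b = v"
      by blast
    let ?V = "f ` S"
    let ?p = "prod P ?V"
    have fin: "finite ?V" using loc_const_finite_image[OF compact f] .
    have "f ((g ^^ ?p) b) = f b" if b: "b \<in> B" for b
    proof -
      have "P (f b) dvd ?p" using fin BS[OF b] by (intro dvd_prodI) auto
      then obtain k where k: "?p = k * P (f b)" by (metis dvd_def mult.commute)
      have "(f ((g ^^ (k * P (f b))) b) = f b) = (f b = f b)"
        by (rule funpow_mult_invariant[OF g, where f = "\<lambda>c. f c = f b"]) (rule P(2), assumption, rule b)
      then show ?thesis using k by simp
    qed
    moreover have "0 < ?p" using P(1) by (intro prod_pos) auto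
    ultimately show ?thesis by blast
  qed
  obtain M :: nat where M: "\<And>x. x \<in> S \<Longrightarrow> \<exists>k. \<bar>k\<bar> \<le> int M \<and> it k x \<in> B"
    using syndetic[OF B(2)] B(1,3) by (metis ex_in_conv subsetD)
  have D: "loc_const X (\<lambda>x. {j \<in> {- int M..int M}. it j x \<in> C})"
    by (intro loc_const_finite_family loc_const_it[OF C]) simp
  from period[OF loc_const_pair[OF r(1) D]]
  obtain p where p: "0 < p" and rC: "\<And>b. b \<in> B \<Longrightarrow> r ((g ^^ p) b) = r b \<and>
      {j \<in> {- int M..int M}. it j ((g ^^ p) b) \<in> C} = {j \<in> {- int M..int M}. it j b \<in> C}"
    unfolding prod.inject by (elim exE conjE) (rule that, assumption, erule (1) bspec)
  \<comment> \<open>The number of \<phi>-steps taken by \<open>n\<close> successive applications of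
    \<open>g\<close>.\<close>
  define R where "R n b = (\<Sum>i<n. r ((g ^^ i) b))" for n b
  have gR: "(g ^^ n) b = it (R n b) b" if "b \<in> B" for n b
    using BS[OF that] by (induction n) (simp_all add: R_def g_def add.commute)
  have R_inv: "R p ((g ^^ p) b) = R p b" if b: "b \<in> B" for b
  proof -
    have "r ((g ^^ i) ((g ^^ p) b)) = r ((g ^^ i) b)" for i
    proof -
      have "(g ^^ i) ((g ^^ p) b) = (g ^^ p) ((g ^^ i) b)"
        by (metis add.commute comp_apply funpow_add)
      then show ?thesis using rC[OF gB[OF b, of i]] by simp
    qed
    then show ?thesis by (simp add: R_def)
  qed
  have finr: "finite (r ` S)" by (rule loc_const_finite_image[OF compact r(1)])
  define m where "m = Max (r ` S)"
  have R_bounds: "0 < R p b" "R p b \<le> int p * m" if b: "b \<in> B" for b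
  proof -
    show "0 < R p b" unfolding R_def using p gB[OF b] r(2) by (intro sum_pos) auto
    have "r ((g ^^ i) b) \<le> m" for i
      unfolding m_def using finr BS[OF gB[OF b]] by (intro Max_ge) auto
    then have "R p b \<le> of_nat (card {..<p}) * m" unfolding R_def by (intro sum_bounded_above)
    then show "R p b \<le> int p * m" by simp
  qed
  \<comment> \<open>All values \<open>R p b\<close> are positive and at most
    \<open>int p * m\<close>, so this factorial is a multiple of each.\<close>
  define Q :: nat where "Q = fact (nat (int p * m))"
  have R_dvd: "R p b dvd int Q" if b: "b \<in> B" for b
  proof -
    have "nat (R p b) dvd Q"
      unfolding Q_def using R_bounds[OF b] by (intro dvd_fact) auto
    then have "int (nat (R p b)) dvd int Q" by (rule of_nat_dvd_iff[THEN iffD2])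
    then show ?thesis using R_bounds(1)[OF b] by simp
  qed
  have base: "it k ((g ^^ p) b) \<in> C \<longleftrightarrow> it k b \<in> C" if "b \<in> B" "\<bar>k\<bar> \<le> int M" for k b
  proof -
    have "k \<in> {j \<in> {- int M..int M}. it j ((g ^^ p) b) \<in> C} \<longleftrightarrow> k \<in> {j \<in> {- int M..int M}. it j b \<in> C}"
      using rC[OF that(1)] by simp
    then show ?thesis using that(2) by (auto simp: abs_le_iff)
  qed
  \<comment> \<open>Advancing by \<open>R p b\<close> replaces \<open>b\<close> by
    \<open>(g ^^ p) b\<close>, where the step length is the same by \<open>R_inv\<close>, so
    \<open>base\<close> can be iterated.\<close>
  have multiples: "it (int n * R p b) (it k b) \<in> C \<longleftrightarrow> it k b \<in> C" if "b \<in> B" "\<bar>k\<bar> \<le> int M" for n k b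
    using that
  proof (induction n arbitrary: b)
    case (Suc n)
    let ?b = "(g ^^ p) b"
    have "it (int (Suc n) * R p b) (it k b) = it (int n * R p ?b) (it k ?b)"
      using Suc.prems gR[of b p] BS R_inv[of b] by (simp add: algebra_simps)
    then show ?case using Suc.IH[OF gB[OF Suc.prems(1)] Suc.prems(2)] base[OF Suc.prems] by simp
  qed simp
  have "it (int Q) x \<in> C \<longleftrightarrow> x \<in> C" if x: "x \<in> S" for x
  proof -
    obtain k where k: "\<bar>k\<bar> \<le> int M" "it k x \<in> B" using M[OF x] by blast
    let ?b = "it k x"
    obtain l where l: "int Q = R p ?b * l" using R_dvd[OF k(2)] by (auto simp: dvd_def)
    have "0 \<le> l"
    proof (rule ccontr)
      assume "\<not> 0 \<le> l"
      then have "R p ?b * l < 0" using R_bounds(1)[OF k(2)] by (intro mult_pos_neg) auto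
      then show False using l by simp
    qed
    then have "int Q = int (nat l) * R p ?b" using l by simp
    then show ?thesis using multiples[OF k(2), of "- k" "nat l"] k(1) x by simp
  qed
  moreover have "0 < Q" by (simp add: Q_def)
  ultimately show ?thesis by blast
qed

subsection \<open>Odometers\<close>

text \<open>A factor map to the rotation of the integers modulo \<open>q\<close>. Fixing the value 0
  at \<open>x0\<close> determines it on the dense orbit of \<open>x0\<close>, which makes factors
  for different moduli compatible.\<close>

definition cyclic_factor :: "'a \<Rightarrow> nat \<Rightarrow> ('a \<Rightarrow> int) \<Rightarrow> bool" where
  "cyclic_factor x0 q h \<longleftrightarrow> 0 < q \<and> loc_const X h \<and> h x0 = 0 \<and>
     (\<forall>x\<in>S. h x \<in> {0..<int q} \<and> h (\<phi> x) = (h x + 1) mod int q)"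

lemma cyclic_factor_it:
  assumes h: "cyclic_factor x0 q h" and x: "x \<in> S"
  shows "h (it n x) = (h x + n) mod int q"
proof (induction n rule: int_induct[where k = 0])
  case base
  then show ?case using h x by (simp add: cyclic_factor_def)
next
  case (step1 i)
  have "h (it (i + 1) x) = (h (it i x) + 1) mod int q"
    using h x int_iterate_step[OF bij x] by (simp add: cyclic_factor_def)
  then show ?case using step1 by (simp add: mod_simps add.assoc)
next
  case (step2 i)
  let ?y = "it (i - 1) x"
  have y: "?y \<in> S" "0 \<le> h ?y" "h ?y < int q" using h x by (auto simp: cyclic_factor_def)
  have "(h ?y + 1) mod int q = (h x + i) mod int q"
    using h y x step2 int_iterate_step[OF bij x, of "i - 1"] by (simp add: cyclic_factor_def)
  then have "(h ?y + 1 - 1) mod int q = (h x + i - 1) mod int q"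
    by (rule mod_diff_cong) simp
  then show ?case using y by (simp add: algebra_simps)
qed

lemma cyclic_factor_orbit:
  assumes "cyclic_factor x0 q h" "x0 \<in> S"
  shows "h (it n x0) = n mod int q"
  using cyclic_factor_it[OF assms] assms(1) by (simp add: cyclic_factor_def)

text \<open>By density every value of \<open>f\<close> occurs along the orbit of \<open>x0\<close>,
  at times that form exactly one class modulo \<open>q\<close>; that class is the value of
  \<open>h\<close>.\<close>

lemma cyclic_factor_exists:
  assumes x0: "x0 \<in> S" and f: "loc_const X f" and q: "0 < q"
    and orbit: "\<And>m n. f (it m x0) = f (it n x0) \<longleftrightarrow> int q dvd m - n"
    and step: "\<And>x y. \<lbrakk>x \<in> S; y \<in> S; f x = f y\<rbrakk> \<Longrightarrow> f (\<phi> x) = f (\<phi> y)"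
  obtains h where "cyclic_factor x0 q h" "\<And>x y. \<lbrakk>x \<in> S; y \<in> S; h x = h y\<rbrakk> \<Longrightarrow> f x = f y"
proof -
  define h where "h x = (SOME n. f (it n x0) = f x) mod int q" for x
  have h: "h x = n mod int q" if "f (it n x0) = f x" for x n
  proof -
    have "f (it (SOME n. f (it n x0) = f x) x0) = f x" using that by (rule someI)
    then have "int q dvd (SOME n. f (it n x0) = f x) - n"
      using orbit that by metis
    then show ?thesis by (simp add: h_def mod_eq_dvd_iff)
  qed
  have ex: "\<exists>n. f (it n x0) = f x" if "x \<in> S" for x
    using orbit_meets_loc_const[OF f x0 that] by metis
  have "loc_const X h" by (rule loc_const_factor[OF f]) (simp add: h_def)
  moreover have "h (\<phi> x) = (h x + 1) mod int q" if x: "x \<in> S" for x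
  proof -
    obtain n where n: "f (it n x0) = f x" using ex[OF x] by blast
    then have "f (it (n + 1) x0) = f (\<phi> x)"
      using step[OF _ x n] x0 int_iterate_step[OF bij x0] by simp
    then show ?thesis using h[OF n] h by (simp add: mod_simps)
  qed
  moreover have "h x0 = 0" using h[of 0 x0] by simp
  moreover have "h x \<in> {0..<int q}" for x using q by (simp add: h_def)
  ultimately have "cyclic_factor x0 q h" using q by (simp add: cyclic_factor_def)
  moreover have "f x = f y" if xy: "x \<in> S" "y \<in> S" "h x = h y" for x y
  proof -
    obtain m n where mn: "f (it m x0) = f x" "f (it n x0) = f y" using ex xy by metis
    then have "m mod int q = n mod int q" using h xy(3) by metis
    then show ?thesis using orbit mn by (metis mod_eq_dvd_iff)
  qed
  ultimately show thesis by (rule that)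
qed

text \<open>The itinerary \<open>w\<close>, the set of times of visits to \<open>C\<close>, is
  determined by the times in \<open>{0..<int Q}\<close> and so is locally constant. It yields the
  factor, with \<open>q\<close> the least period of the itinerary of \<open>x0\<close>.\<close>

lemma cyclic_factor_periodic_set:
  assumes x0: "x0 \<in> S" and C: "loc_const X (\<lambda>x. x \<in> C)"
    and Q: "0 < Q" "\<And>x. x \<in> S \<Longrightarrow> it (int Q) x \<in> C \<longleftrightarrow> x \<in> C"
  obtains q h where "cyclic_factor x0 q h" "\<And>x y. \<lbrakk>x \<in> S; y \<in> S; h x = h y\<rbrakk> \<Longrightarrow> x \<in> C \<longleftrightarrow> y \<in> C"
proof -
  define w where "w x = {j. it j x \<in> C}" for x
  have w_it: "w (it k x) = {j. j + k \<in> w x}" if "x \<in> S" for k x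
    using that by (simp add: w_def)
  have perQ: "j + int Q \<in> w x \<longleftrightarrow> j \<in> w x" if "x \<in> S" for j x
    using Q(2)[of "it j x"] that by (simp add: w_def add.commute)
  have perQm: "j + i * int Q \<in> w x \<longleftrightarrow> j \<in> w x" if "x \<in> S" for i j x
  proof (induction i rule: int_induct[where k = 0])
    case base
    then show ?case by simp
  next
    case (step1 i)
    then show ?case using perQ[OF that, of "j + i * int Q"] by (simp add: algebra_simps)
  next
    case (step2 i)
    then show ?case using perQ[OF that, of "j + (i - 1) * int Q"] by (simp add: algebra_simps)
  qed
  have w_mod: "j mod int Q \<in> w x \<longleftrightarrow> j \<in> w x" if "x \<in> S" for j x
    using perQm[OF that, of "j mod int Q" "j div int Q"] by simp
  have lc: "loc_const X w"
  proof (rule loc_const_factor)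
    show "loc_const X (\<lambda>x. {j \<in> {0..<int Q}. it j x \<in> C})"
      by (intro loc_const_finite_family loc_const_it[OF C]) simp
    fix x y assume xy: "x \<in> S" "y \<in> S" "{j \<in> {0..<int Q}. it j x \<in> C} = {j \<in> {0..<int Q}. it j y \<in> C}"
    have "j \<in> w x \<longleftrightarrow> j \<in> w y" for j
    proof -
      have "j mod int Q \<in> {j \<in> {0..<int Q}. it j x \<in> C} \<longleftrightarrow> j mod int Q \<in> {j \<in> {0..<int Q}. it j y \<in> C}"
        using xy(3) by simp
      then have "j mod int Q \<in> w x \<longleftrightarrow> j mod int Q \<in> w y" using Q(1) by (simp add: w_def)
      then show ?thesis using w_mod xy by simp
    qed
    then show "w x = w y" by blast
  qed
  \<comment> \<open>The periods of the itinerary of \<open>x0\<close>. They form a group of integers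
    containing \<open>Q\<close>, so they are the multiples of the least positive one.\<close>
  define stab where "stab k \<longleftrightarrow> (\<forall>j. j + k \<in> w x0 \<longleftrightarrow> j \<in> w x0)" for k
  have orbit: "w (it m x0) = w (it n x0) \<longleftrightarrow> stab (m - n)" for m n
  proof
    assume eq: "w (it m x0) = w (it n x0)"
    show "stab (m - n)" unfolding stab_def
    proof
      fix j
      have "j - n \<in> w (it m x0) \<longleftrightarrow> j - n \<in> w (it n x0)" using eq by simp
      then show "j + (m - n) \<in> w x0 \<longleftrightarrow> j \<in> w x0" using w_it[OF x0] by (simp add: algebra_simps)
    qed
  next
    assume st: "stab (m - n)"
    have "j \<in> w (it m x0) \<longleftrightarrow> j \<in> w (it n x0)" for j
      using st[unfolded stab_def, rule_format, of "j + n"] w_it[OF x0] by (simp add: algebra_simps)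
    then show "w (it m x0) = w (it n x0)" by blast
  qed
  have stab_add: "stab (a + b)" if "stab a" "stab b" for a b
  proof -
    have "j + (a + b) \<in> w x0 \<longleftrightarrow> j \<in> w x0" for j
      using that(1)[unfolded stab_def, rule_format, of j] that(2)[unfolded stab_def, rule_format, of "j + a"]
      by (simp add: add.assoc)
    then show ?thesis by (simp add: stab_def)
  qed
  have stab_minus: "stab (- a)" if "stab a" for a
    unfolding stab_def using that[unfolded stab_def, rule_format, of "_ - a"] by simp
  have stab_mult: "stab (k * a)" if "stab a" for k a
  proof (induction k rule: int_induct[where k = 0])
    case base
    then show ?case by (simp add: stab_def)
  next
    case (step1 i)
    then show ?case using stab_add[OF step1(2) that] by (simp add: algebra_simps)
  next
    case (step2 i)
    then show ?case using stab_add[OF step2(2) stab_minus[OF that]] by (simp add: algebra_simps)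
  qed
  have "0 < Q \<and> stab (int Q)" using Q(1) perQ[OF x0] by (simp add: stab_def)
  define q where "q = (LEAST n. 0 < n \<and> stab (int n))"
  have q: "0 < q" "stab (int q)"
    using LeastI[of "\<lambda>n. 0 < n \<and> stab (int n)", OF \<open>0 < Q \<and> stab (int Q)\<close>] by (simp_all add: q_def)
  have q_dvd: "stab k \<longleftrightarrow> int q dvd k" for k
  proof
    assume "stab k"
    then have "stab (k + (- (k div int q)) * int q)" by (intro stab_add stab_mult q(2))
    then have "stab (k - k div int q * int q)" by simp
    then have "stab (k mod int q)" by (simp only: minus_div_mult_eq_mod)
    then have st: "stab (int (nat (k mod int q)))" using q(1) by simp
    have "nat (k mod int q) < q" using q(1) by (simp add: nat_less_iff)
    then have "\<not> 0 < nat (k mod int q)"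
      using st not_less_Least[of "nat (k mod int q)" "\<lambda>n. 0 < n \<and> stab (int n)"] by (auto simp: q_def)
    then have "k mod int q = 0" using q(1) pos_mod_sign[of "int q" k] by linarith
    then show "int q dvd k" by auto
  next
    assume "int q dvd k"
    then show "stab k" using stab_mult[OF q(2)] by (auto simp: dvd_def mult.commute)
  qed
  have orbit_q: "w (it m x0) = w (it n x0) \<longleftrightarrow> int q dvd m - n" for m n
    using orbit q_dvd by simp
  have "w (\<phi> x) = w (\<phi> y)" if "x \<in> S" "y \<in> S" "w x = w y" for x y
    using that w_it[of x 1] w_it[of y 1] by (simp add: it_1)
  then show thesis
  proof (rule cyclic_factor_exists[OF x0 lc q(1) orbit_q])
    fix h assume "cyclic_factor x0 q h" and h: "\<And>x y. \<lbrakk>x \<in> S; y \<in> S; h x = h y\<rbrakk> \<Longrightarrow> w x = w y"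
    moreover have "x \<in> C \<longleftrightarrow> 0 \<in> w x" for x by (simp add: w_def)
    then have "x \<in> C \<longleftrightarrow> y \<in> C" if "x \<in> S" "y \<in> S" "h x = h y" for x y
      using h[OF that] by metis
    ultimately show thesis using that by blast
  qed
qed

text \<open>Along the orbit of \<open>x0\<close> the pair of factors repeats its value exactly after
  common multiples of the two moduli.\<close>

lemma cyclic_factor_lcm:
  assumes x0: "x0 \<in> S" and h: "cyclic_factor x0 q h" and h': "cyclic_factor x0 q' h'"
  obtains h'' where "cyclic_factor x0 (lcm q q') h''"
proof -
  have lc: "loc_const X (\<lambda>x. (h x, h' x))"
    using h h' by (intro loc_const_pair) (auto simp: cyclic_factor_def)
  have "(h (it m x0), h' (it m x0)) = (h (it n x0), h' (it n x0)) \<longleftrightarrow> int (lcm q q') dvd m - n" for m n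
    using cyclic_factor_orbit[OF h x0] cyclic_factor_orbit[OF h' x0]
    by (simp add: mod_eq_dvd_iff lcm_int_int_eq[symmetric] del: lcm_int_int_eq)
  moreover have "(h (\<phi> x), h' (\<phi> x)) = (h (\<phi> y), h' (\<phi> y))"
    if "x \<in> S" "y \<in> S" "(h x, h' x) = (h y, h' y)" for x y
    using that h h' by (simp add: cyclic_factor_def)
  moreover have "0 < lcm q q'" using h h' by (simp add: cyclic_factor_def lcm_pos_nat)
  ultimately show thesis
    using cyclic_factor_exists[OF x0 lc, of "lcm q q'"] that by blast
qed

text \<open>Both factors vanish at \<open>x0\<close>, so along its orbit they are residues of the
  same time; by density the pair of values at \<open>x\<close> occurs on that orbit.\<close>

lemma cyclic_factor_mod:
  assumes x0: "x0 \<in> S" and h: "cyclic_factor x0 q h" and h': "cyclic_factor x0 q' h'"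
    and "q dvd q'" and x: "x \<in> S"
  shows "h' x mod int q = h x"
proof -
  have lc: "loc_const X (\<lambda>x. (h x, h' x))"
    using h h' by (intro loc_const_pair) (auto simp: cyclic_factor_def)
  obtain n where "(h (it n x0), h' (it n x0)) = (h x, h' x)"
    using orbit_meets_loc_const[OF lc x0 x] by metis
  then have n: "h x = n mod int q" "h' x = n mod int q'"
    using cyclic_factor_orbit[OF h x0] cyclic_factor_orbit[OF h' x0] by auto
  show ?thesis unfolding n using assms(4) by (simp add: mod_mod_cancel)
qed

text \<open>Countably many clopen sets separate points, and each is determined by a cyclic factor.
  Successive least common multiples put the moduli into a divisibility chain, and the factors for
  these moduli are the coordinates of a conjugacy.\<close>

lemma is_odometer_if_periodic:
  assumes per: "\<And>C. loc_const X (\<lambda>x. x \<in> C) \<Longrightarrow> \<exists>Q>0. \<forall>x\<in>S. it (int Q) x \<in> C \<longleftrightarrow> x \<in> C"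
  shows "is_odometer X \<phi>"
proof -
  obtain x0 where x0: "x0 \<in> S" using nonempty by blast
  obtain C :: "nat \<Rightarrow> 'a set" where C: "\<And>n. loc_const X (\<lambda>z. z \<in> C n)"
    and sep: "\<And>x y. \<lbrakk>x \<in> S; y \<in> S; x \<noteq> y\<rbrakk> \<Longrightarrow> \<exists>n. x \<in> C n \<and> y \<notin> C n"
    by (rule countable_separation) blast
  have "\<exists>q h. cyclic_factor x0 q h \<and> (\<forall>x\<in>S. \<forall>y\<in>S. h x = h y \<longrightarrow> (x \<in> C n \<longleftrightarrow> y \<in> C n))" for n
  proof -
    obtain Q where Q: "0 < Q" "\<And>x. x \<in> S \<Longrightarrow> it (int Q) x \<in> C n \<longleftrightarrow> x \<in> C n"
      using per[OF C[of n]] by blast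
    show ?thesis by (rule cyclic_factor_periodic_set[OF x0 C[of n] Q]) blast+
  qed
  then obtain q h where h: "\<And>n. cyclic_factor x0 (q n) (h n)"
    and hC: "\<And>n x y. \<lbrakk>x \<in> S; y \<in> S; h n x = h n y\<rbrakk> \<Longrightarrow> x \<in> C n \<longleftrightarrow> y \<in> C n"
    by metis
  define m where "m = rec_nat (q 0) (\<lambda>n k. lcm k (q (Suc n)))"
  have m_simps: "m 0 = q 0" "m (Suc n) = lcm (m n) (q (Suc n))" for n by (simp_all add: m_def)
  have "\<exists>H. cyclic_factor x0 (m n) H" for n
  proof (induction n)
    case 0
    then show ?case using h[of 0] by (auto simp: m_simps)
  next
    case (Suc n)
    then obtain H where H: "cyclic_factor x0 (m n) H" by blast
    show ?case
      unfolding m_simps by (rule cyclic_factor_lcm[OF x0 H h[of "Suc n"]]) blast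
  qed
  then obtain H where H: "\<And>n. cyclic_factor x0 (m n) (H n)" by metis
  have m_pos: "0 < m n" for n using H by (simp add: cyclic_factor_def)
  have m_dvd: "m n dvd m (Suc n)" for n by (simp add: m_simps)
  have qm: "q n dvd m n" for n by (cases n) (simp_all add: m_simps)
  have H_step: "H (Suc n) x mod int (m n) = H n x" if "x \<in> S" for n x
    by (rule cyclic_factor_mod[OF x0 H H m_dvd that])
  have H_range: "H n x \<in> {0..<int (m n)}" and H_\<phi>: "H n (\<phi> x) = (H n x + 1) mod int (m n)"
    if "x \<in> S" for n x
    using H[of n] that by (auto simp: cyclic_factor_def)
  have H_lc: "loc_const X (H n)" for n using H[of n] by (simp add: cyclic_factor_def)
  define f where "f x = (\<lambda>n. H n x)" for x
  have inj: "inj_on f S"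
  proof (rule inj_onI, rule ccontr)
    fix x y assume xy: "x \<in> S" "y \<in> S" "f x = f y" "x \<noteq> y"
    then obtain n where n: "x \<in> C n" "y \<notin> C n" using sep by blast
    have "H n x = H n y" using xy(3) by (metis f_def)
    then have "h n x = h n y"
      using cyclic_factor_mod[OF x0 h H qm xy(1), of n] cyclic_factor_mod[OF x0 h H qm xy(2), of n] by simp
    then show False using hC[OF xy(1,2)] n by blast
  qed
  have mono: "m i \<le> m j" if "i \<le> j" for i j
    using that lift_Suc_mono_le[of m] m_dvd m_pos by (metis dvd_imp_le)
  have "filterlim m at_top sequentially"
    unfolding filterlim_at_top
  proof
    fix K
    \<comment> \<open>Bounded moduli would all divide one factorial, and injectivity of
      \<open>f\<close> would then make \<open>x0\<close> periodic.\<close>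
    have "\<exists>n. K \<le> m n"
    proof (rule ccontr)
      assume "\<nexists>n. K \<le> m n"
      then have "m n dvd fact K" for n
        using m_pos[of n] by (intro dvd_fact) (auto simp: not_le intro: less_imp_le)
      then have "f (it (int (fact K)) x0) = f x0"
        using cyclic_factor_orbit[OF H x0] H by (auto simp: f_def cyclic_factor_def fun_eq_iff simp del: of_nat_fact)
      then have "it (int (fact K)) x0 = x0" using inj x0 by (simp add: inj_on_eq_iff del: of_nat_fact)
      then show False using aperiodic[OF x0] by fastforce
    qed
    then show "eventually (\<lambda>n. K \<le> m n) sequentially"
      using mono by (auto simp: eventually_sequentially intro: order_trans)
  qed
  then have type: "odometer_type m"
    using m_pos m_dvd by (simp add: odometer_type_def)
  have "continuous_map X (odometer_space m) f"
    unfolding odometer_space_def continuous_map_in_subtopology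
  proof (intro conjI)
    show "continuous_map X (product_topology (\<lambda>n. discrete_topology (carrier (integer_mod_group (m n)))) UNIV) f"
      unfolding continuous_map_componentwise_UNIV
    proof
      fix n
      have "continuous_map X (subtopology (discrete_topology UNIV) (carrier (integer_mod_group (m n)))) (H n)"
        using H_lc[of n] H_range m_pos[of n]
        by (auto simp: continuous_map_in_subtopology loc_const_iff_continuous_map carrier_integer_mod_group
            simp del: subtopology_discrete_topology)
      then show "continuous_map X (discrete_topology (carrier (integer_mod_group (m n)))) (\<lambda>x. f x n)"
        by (simp add: subtopology_discrete_topology f_def)
    qed
    show "f \<in> topspace X \<rightarrow> {y. \<forall>n. y (Suc n) mod int (m n) = y n}"
      using H_step by (simp add: f_def)
  qed
  moreover have "Hausdorff_space (odometer_space m)"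
    unfolding odometer_space_def
    by (intro Hausdorff_space_subtopology) (simp add: Hausdorff_space_product_topology)
  moreover have "f ` S = topspace (odometer_space m)"
  proof
    show "f ` S \<subseteq> topspace (odometer_space m)"
      using H_range H_step by (auto simp: topspace_odometer_space[OF type] f_def)
    show "topspace (odometer_space m) \<subseteq> f ` S"
    proof
      fix y assume "y \<in> topspace (odometer_space m)"
      then have y: "y n \<in> {0..<int (m n)}" "y (Suc n) mod int (m n) = y n" for n
        by (auto simp: topspace_odometer_space[OF type])
      \<comment> \<open>The points whose coordinate \<open>n\<close> is that of \<open>y\<close>
        form a decreasing sequence of nonempty closed sets; a common point is the preimage.\<close>
      let ?K = "\<lambda>n. {x \<in> S. H n x = y n}"
      have "?K n \<noteq> {}" for n
      proof -
        have "H n (it (y n) x0) = y n" using cyclic_factor_orbit[OF H x0] y(1)[of n] by simp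
        then show ?thesis using x0 it_closed by blast
      qed
      moreover have "closedin X (?K n)" for n by (rule loc_const_closedin[OF H_lc])
      moreover have "decseq ?K"
      proof (rule decseq_SucI)
        have "H n x = y n" if "x \<in> S" "H (Suc n) x = y (Suc n)" for n x
          using y(2)[of n] H_step[OF that(1), of n] that(2) by simp
        then show "?K (Suc n) \<subseteq> ?K n" for n by blast
      qed
      ultimately have "(\<Inter>n. ?K n) \<noteq> {}" by (intro compact_space_imp_nest[OF compact])
      then obtain x where "x \<in> S" "\<forall>n. H n x = y n" by auto
      then show "y \<in> f ` S" by (intro image_eqI[of _ _ x]) (auto simp: f_def)
    qed
  qed
  ultimately have "homeomorphic_map X (odometer_space m) f"
    using compact inj by (intro continuous_imp_homeomorphic_map)
  moreover have "f (\<phi> x) = odometer_map m (f x)" if "x \<in> S" for x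
    using H_\<phi>[OF that] by (simp add: f_def odometer_map_def)
  ultimately show ?thesis
    using type by (auto simp: is_odometer_def)
qed

text \<open>
  In an odometer a cocycle factors through a finite quotient, so that some power \<open>s\<close> of the shift acts
  trivially on that quotient; then \<open>a s a s\<inverse>\<close>, for \<open>a\<close> a single lamp, is a nontrivial involution that
  acts by powers of \<open>\<phi>\<close> constant along its own orbits, which aperiodicity forbids.
\<close>

lemma odometer_not_contains_lamplighter_group:
  assumes "is_odometer X \<phi>" shows "\<not> contains_copy_of G lamplighter_group"
proof
  assume "contains_copy_of G lamplighter_group"
  then obtain \<Phi> where \<Phi>: "\<Phi> \<in> hom lamplighter_group G" "inj_on \<Phi> (carrier lamplighter_group)"
    by (rule contains_copy_ofE)
  interpret G: group G by (rule group_G)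
  interpret \<Phi>: group_hom lamplighter_group G \<Phi>
    using \<Phi>(1) by (simp add: group_hom_def group_hom_axioms_def group_lamplighter_group group_G)
  obtain m f where type: "odometer_type m" and f: "homeomorphic_map X (odometer_space m) f"
    and equiv: "\<And>x. x \<in> S \<Longrightarrow> f (\<phi> x) = odometer_map m (f x)"
    using assms by (auto simp: is_odometer_def)
  have m_pos: "0 < m n" for n using type by (simp add: odometer_type_def)
  define h where "h n x = f x n" for n x
  have f_surj: "f ` S = topspace (odometer_space m)" and f_inj: "inj_on f S"
    using f by (auto simp: homeomorphic_imp_surjective_map homeomorphic_imp_injective_map)
  have h_range: "h n x \<in> {0..<int (m n)}" and h_step: "h (Suc n) x mod int (m n) = h n x"
    if "x \<in> S" for n x
  proof -
    have "f x \<in> topspace (odometer_space m)" using that f_surj by blast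
    then show "h n x \<in> {0..<int (m n)}" "h (Suc n) x mod int (m n) = h n x"
      unfolding topspace_odometer_space[OF type] h_def by blast+
  qed
  have "(\<lambda>_. 0) \<in> f ` S"
    unfolding f_surj topspace_odometer_space[OF type] using m_pos by simp
  then obtain x0 where x0: "x0 \<in> S" "f x0 = (\<lambda>_. 0)" by (metis imageE)
  have h_lc: "loc_const X (h n)" for n
  proof -
    have "continuous_map X (product_topology (\<lambda>n. discrete_topology (carrier (integer_mod_group (m n)))) UNIV) f"
      using homeomorphic_imp_continuous_map[OF f]
      by (simp add: odometer_space_def continuous_map_in_subtopology)
    then have "continuous_map X (discrete_topology (carrier (integer_mod_group (m n)))) (h n)"
      by (simp add: continuous_map_componentwise_UNIV h_def[abs_def])
    then have "continuous_map X (subtopology (discrete_topology UNIV) (carrier (integer_mod_group (m n)))) (h n)"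
      by (simp add: subtopology_discrete_topology)
    then show ?thesis
      unfolding loc_const_iff_continuous_map by (rule continuous_map_into_fulltopology)
  qed
  have h_factor: "cyclic_factor x0 (m n) (h n)" for n
    using h_lc h_range m_pos x0 equiv by (simp add: cyclic_factor_def h_def odometer_map_def)
  have h_mono: "h n x = h n y \<Longrightarrow> h k x = h k y" if "k \<le> n" "x \<in> S" "y \<in> S" for k n x y
    using that(1)
  proof (induction n rule: dec_induct)
    case (step n)
    then have "h n x = h n y" using h_step[OF that(2), of n] h_step[OF that(3), of n] by simp
    then show ?case using step by simp
  qed
  \<comment> \<open>Compactness is used twice: at each point some level determines \<open>c\<close>,
    as otherwise nested closed sets would yield a second point with the same coordinates; then a
    finite cover gives one level for all points.\<close>
  have factor: "\<exists>n. \<forall>x\<in>S. \<forall>y\<in>S. h n x = h n y \<longrightarrow> c x = c y" if c: "loc_const X c" for c :: "'a \<Rightarrow> int"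
  proof -
    have "\<exists>n. \<forall>y\<in>S. h n y = h n x \<longrightarrow> c y = c x" if x: "x \<in> S" for x
    proof (rule ccontr)
      assume no: "\<nexists>n. \<forall>y\<in>S. h n y = h n x \<longrightarrow> c y = c x"
      let ?K = "\<lambda>n. {y \<in> S. h n y = h n x \<and> c y \<noteq> c x}"
      have "closedin X (?K n)" for n
        using loc_const_closedin[OF loc_const_pair[OF h_lc[of n] c], of "\<lambda>(a, b). a = h n x \<and> b \<noteq> c x"] by simp
      moreover have "?K n \<noteq> {}" for n using no by blast
      moreover have "decseq ?K"
      proof (rule decseq_SucI)
        show "?K (Suc n) \<subseteq> ?K n" for n
        proof
          fix y assume y: "y \<in> ?K (Suc n)"
          then have "h n y = h n x" by (intro h_mono[of n "Suc n" y x]) (simp_all add: x)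
          then show "y \<in> ?K n" using y by simp
        qed
      qed
      ultimately have "(\<Inter>n. ?K n) \<noteq> {}" by (intro compact_space_imp_nest[OF compact])
      then obtain y where y: "y \<in> S" "\<And>n. h n y = h n x" "c y \<noteq> c x" by auto
      then have "f y = f x" by (auto simp: h_def)
      then show False using f_inj x y(1,3) by (metis inj_onD)
    qed
    then obtain N where N: "\<And>x y. \<lbrakk>x \<in> S; y \<in> S; h (N x) y = h (N x) x\<rbrakk> \<Longrightarrow> c y = c x"
      by metis
    let ?U = "\<lambda>x. {y \<in> S. h (N x) y = h (N x) x}"
    have "openin X (?U x)" for x by (rule loc_const_openin[OF h_lc])
    moreover have "S \<subseteq> \<Union>(?U ` S)" by blast
    ultimately obtain F where "finite F" "F \<subseteq> ?U ` S" and cover: "S \<subseteq> \<Union>F"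
      using compact[unfolded compact_space_alt, rule_format, of "?U ` S"] by blast
    then obtain T where T: "T \<subseteq> S" "finite T" "F = ?U ` T" by (meson finite_subset_image)
    have "c y = c z" if yz: "y \<in> S" "z \<in> S" "h (Max (N ` T)) y = h (Max (N ` T)) z" for y z
    proof -
      obtain x where x: "x \<in> T" "h (N x) y = h (N x) x" using cover T(3) yz(1) by blast
      have "N x \<le> Max (N ` T)" using T(2) x(1) by (intro Max_ge) auto
      then have "h (N x) z = h (N x) x" using h_mono[OF _ yz(1,2), of "N x"] yz(3) x(2) by metis
      moreover have "x \<in> S" using x(1) T(1) by blast
      ultimately show ?thesis using N[OF _ yz(1) x(2)] N[OF _ yz(2)] by metis
    qed
    then show ?thesis by blast
  qed
  \<comment> \<open>Some cocycle of \<open>u\<close> depends only on the coordinate at level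
    \<open>n\<close>. Such elements act on the coordinates of that level and are closed under
    products.\<close>
  define compat where "compat n u \<longleftrightarrow>
      (\<exists>c. (\<forall>x\<in>S. \<forall>y\<in>S. h n x = h n y \<longrightarrow> c x = c y) \<and> (\<forall>x\<in>S. u x = it (c x) x))" for n u
  have compat_ex: "\<exists>n. compat n u" if u: "u \<in> carrier G" for u
  proof -
    obtain c where "loc_const X c" and c: "\<forall>x\<in>S. u x = it (c x) x" using G_carrier(4)[OF u] by blast
    then show ?thesis using factor[of c] unfolding compat_def by blast
  qed
  have compat_mono: "compat n u" if "compat k u" "k \<le> n" for k n u
    using that h_mono[OF that(2)] unfolding compat_def by metis
  have compat_h: "h n (u x) = h n (u y)" if u: "compat n u" and xy: "x \<in> S" "y \<in> S" "h n x = h n y" for n u x y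
  proof -
    obtain c where "c x = c y" "u x = it (c x) x" "u y = it (c y) y"
      using u xy unfolding compat_def by blast
    then show ?thesis using cyclic_factor_it[OF h_factor] xy by simp
  qed
  have compat_mult: "compat n (u \<otimes>\<^bsub>G\<^esub> v)"
    if uv: "u \<in> carrier G" "v \<in> carrier G" "compat n u" "compat n v" for n u v
  proof -
    obtain c where c: "\<And>x y. \<lbrakk>x \<in> S; y \<in> S; h n x = h n y\<rbrakk> \<Longrightarrow> c x = c y" "\<And>x. x \<in> S \<Longrightarrow> u x = it (c x) x"
      using uv(3) unfolding compat_def by blast
    obtain d where d: "\<And>x y. \<lbrakk>x \<in> S; y \<in> S; h n x = h n y\<rbrakk> \<Longrightarrow> d x = d y" "\<And>x. x \<in> S \<Longrightarrow> v x = it (d x) x"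
      using uv(4) unfolding compat_def by blast
    have "c (v x) + d x = c (v y) + d y" if "x \<in> S" "y \<in> S" "h n x = h n y" for x y
      using d(1)[OF that] c(1)[OF _ _ compat_h[OF uv(4) that]] G_closed[OF uv(2)] that by simp
    moreover have "(u \<otimes>\<^bsub>G\<^esub> v) x = it (c (v x) + d x) x" if "x \<in> S" for x
      using that uv c(2)[of "v x"] d(2)[of x] G_closed[OF uv(2)] by (simp add: G_mult)
    ultimately show ?thesis
      unfolding compat_def by (intro exI[of _ "\<lambda>x. c (v x) + d x"]) blast
  qed
  let ?a = "\<Phi> (lamp {0} 0)" and ?t = "\<lambda>k. \<Phi> (lamp {} k)"
  have aG [simp]: "?a \<in> carrier G" and tG [simp]: "?t k \<in> carrier G" for k by simp_all
  have t_add: "?t (k + l) = ?t k \<otimes>\<^bsub>G\<^esub> ?t l" for k l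
    using \<Phi>.hom_mult[of "lamp {} k" "lamp {} l"] by simp
  have t_0: "?t 0 = \<one>\<^bsub>G\<^esub>" using \<Phi>.hom_one by (simp add: one_lamplighter_group)
  have t_inv: "?t k (?t (- k) x) = x" if "x \<in> S" for k x
  proof -
    have "?t k \<otimes>\<^bsub>G\<^esub> ?t (- k) = \<one>\<^bsub>G\<^esub>" by (metis add.right_inverse t_add t_0)
    then show ?thesis using G_mult[OF tG tG that, of k "- k"] that by (simp add: G_one)
  qed
  have aa: "?a (?a x) = x" if "x \<in> S" for x
  proof -
    have "?a \<otimes>\<^bsub>G\<^esub> ?a = \<one>\<^bsub>G\<^esub>"
      using \<Phi>.hom_mult[of "lamp {0} 0" "lamp {0} 0"] t_0 by simp
    then show ?thesis using G_mult[OF aG aG that] that by (simp add: G_one)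
  qed
  obtain n1 n2 n3 where "compat n1 ?a" "compat n2 (?t 1)" "compat n3 (?t (- 1))"
    using compat_ex aG tG by metis
  \<comment> \<open>Both directions of the shift are included because closure of
    \<open>compat\<close> is established for products only.\<close>
  then obtain n where n: "compat n ?a" "compat n (?t 1)" "compat n (?t (- 1))"
    using compat_mono[where n = "max n1 (max n2 n3)"] by (metis max.cobounded1 max.cobounded2 max.coboundedI2)
  have t_compat: "compat n (?t (int k))" "compat n (?t (- int k))" for k
  proof (induction k)
    case 0
    have "compat n (?t 0)"
      unfolding compat_def by (intro exI[of _ "\<lambda>_. 0"]) (simp add: t_0 G_one)
    then show "compat n (?t (int 0))" "compat n (?t (- int 0))" by simp_all
  next
    case (Suc k)
    show "compat n (?t (int (Suc k)))"
      using compat_mult[OF tG tG n(2) Suc(1)] t_add[of 1 "int k"] by simp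
    show "compat n (?t (- int (Suc k)))"
      using compat_mult[OF tG tG n(3) Suc(2)] t_add[of "- 1" "- int k"] by simp
  qed
  have "finite (h n ` S)" by (rule loc_const_finite_image[OF compact h_lc])
  moreover have "h n (?t 1 b) = h n (?t 1 c) \<longleftrightarrow> h n b = h n c" if bc: "b \<in> S" "c \<in> S" for b c
  proof
    assume "h n (?t 1 b) = h n (?t 1 c)"
    then have "h n (?t (- 1) (?t 1 b)) = h n (?t (- 1) (?t 1 c))"
      using compat_h[OF n(3)] G_closed[OF tG] bc by blast
    then show "h n b = h n c" using t_inv[OF bc(1), of "- 1"] t_inv[OF bc(2), of "- 1"] by simp
  qed (rule compat_h[OF n(2) bc])
  ultimately obtain M where M: "0 < M" "\<And>b. b \<in> S \<Longrightarrow> h n ((?t 1 ^^ M) b) = h n b"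
    using finite_image_period[OF G_carrier(2)[OF tG[of 1]]] by blast
  have "(?t 1 ^^ k) b = ?t (int k) b" if "b \<in> S" for k b
  proof (induction k)
    case 0
    then show ?case using that by (simp add: t_0 G_one)
  next
    case (Suc k)
    then show ?case using t_add[of 1 "int k"] G_mult[OF tG tG that] by simp
  qed
  then have s: "h n (?t (int M) b) = h n b" if "b \<in> S" for b using M(2) that by simp
  have s': "h n (?t (- int M) b) = h n b" if "b \<in> S" for b
    using s[OF G_closed[OF tG[of "- int M"] that]] t_inv[OF that] by simp
  \<comment> \<open>The image of the element with lamps at 0 and \<open>M\<close>; as
    \<open>M\<close> is positive, it is a nontrivial involution.\<close>
  define u where "u = ?a \<otimes>\<^bsub>G\<^esub> (?t (int M) \<otimes>\<^bsub>G\<^esub> (?a \<otimes>\<^bsub>G\<^esub> ?t (- int M)))"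
  have u_lamp: "u = \<Phi> (lamp (sym_diff {0} {int M}) 0)"
    by (simp add: u_def flip: \<Phi>.hom_mult)
  have uG: "u \<in> carrier G" by (simp add: u_def)
  have "compat n u"
    unfolding u_def by (intro compat_mult n(1) t_compat G.m_closed aG tG)
  then obtain c where c: "\<And>x y. \<lbrakk>x \<in> S; y \<in> S; h n x = h n y\<rbrakk> \<Longrightarrow> c x = c y" "\<And>x. x \<in> S \<Longrightarrow> u x = it (c x) x"
    unfolding compat_def by blast
  have "u x = x" if x: "x \<in> S" for x
  proof -
    let ?y = "?t (- int M) x"
    have y: "?y \<in> S" "?a ?y \<in> S" "?t (int M) (?a ?y) \<in> S" using x G_closed aG tG by simp_all
    have "u x = ?a (?t (int M) (?a ?y))" using x y by (simp add: u_def G_mult)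
    \<comment> \<open>At level \<open>n\<close> the shift powers act trivially and the two single
      lamps cancel, so \<open>x\<close> and \<open>u x\<close> have the same displacement.\<close>
    also have "h n \<dots> = h n (?a (?a ?y))" using compat_h[OF n(1)] s[OF y(2)] y by blast
    also have "\<dots> = h n x" using aa[OF y(1)] s'[OF x] by simp
    finally have cx: "c (u x) = c x" using c(1) G_closed[OF uG x] x by blast
    have "u \<otimes>\<^bsub>G\<^esub> u = \<Phi> (lamp {} 0)"
      unfolding u_lamp by (simp flip: \<Phi>.hom_mult)
    then have "u (u x) = x" using G_mult[OF uG uG x] x by (simp add: t_0 G_one)
    moreover have "u (u x) = it (c x + c x) x"
      using c(2)[OF G_closed[OF uG x]] c(2)[OF x] cx x by simp
    ultimately have "c x + c x = 0" using aperiodic[OF x] by metis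
    then show ?thesis using c(2)[OF x] by simp
  qed
  then have "\<Phi> (lamp (sym_diff {0} {int M}) 0) = \<one>\<^bsub>G\<^esub>"
    using uG by (intro G_eqI) (simp_all add: u_lamp[symmetric] G_one)
  then have "\<Phi> (lamp (sym_diff {0} {int M}) 0) = \<Phi> (lamp {} 0)" by (simp add: t_0)
  then have "lamp (sym_diff {0} {int M}) 0 = lamp {} 0"
    by (rule inj_onD[OF \<Phi>(2)]) simp_all
  then show False using M(1) by auto
qed

text \<open>Without a copy, every clopen subset of a small clopen \<open>B\<close> would be periodic
  under the first return map, hence every clopen set periodic under \<phi>.\<close>

lemma not_odometer_contains_lamplighter_group:
  assumes "\<not> is_odometer X \<phi>"
  shows "contains_copy_of (commutator_subgroup G) lamplighter_group"
proof -
  obtain x0 where x0: "x0 \<in> S" using nonempty by blast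
  have "\<exists>C. loc_const X (\<lambda>z. z \<in> C) \<and> x0 \<in> C \<and> it j x0 \<notin> C" if "j \<noteq> 0" for j
  proof -
    have "x0 \<noteq> it j x0" using aperiodic[OF x0, of j] that by metis
    then show ?thesis using separation[OF x0 it_closed[OF x0]] by metis
  qed
  then obtain C where C: "\<And>j. j \<noteq> 0 \<Longrightarrow> loc_const X (\<lambda>z. z \<in> C j)"
    "\<And>j. j \<noteq> 0 \<Longrightarrow> x0 \<in> C j" "\<And>j. j \<noteq> 0 \<Longrightarrow> it j x0 \<notin> C j"
    by metis
  \<comment> \<open>A clopen neighbourhood of \<open>x0\<close>. Each \<open>C j\<close> contains
    \<open>x0\<close> but not \<open>it j x0\<close>, so points of \<open>B\<close> are outside
    \<open>C j\<close>, hence outside \<open>B\<close>, after \<open>j\<close> steps.\<close>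
  define B where "B = {x \<in> S. \<forall>j\<in>{1, 2, 3}. x \<in> C j \<and> it j x \<notin> C j}"
  have "x0 \<in> B" using x0 C by (simp add: B_def)
  then have B: "B \<subseteq> S" "B \<noteq> {}" by (auto simp: B_def)
  have "loc_const X (\<lambda>x. {j \<in> {1, 2, 3}. x \<in> C j \<and> it j x \<notin> C j})"
  proof (rule loc_const_finite_family)
    fix j :: int assume "j \<in> {1, 2, 3}"
    then have "loc_const X (\<lambda>z. z \<in> C j)" by (intro C(1)) auto
    then show "loc_const X (\<lambda>x. x \<in> C j \<and> it j x \<notin> C j)"
      using loc_const_it[of "\<lambda>z. z \<in> C j" j] by (intro loc_const_comp2[where h = "\<lambda>a b. a \<and> \<not> b"])
  qed simp
  then have B_lc: "loc_const X (\<lambda>x. x \<in> B)"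
    by (rule loc_const_factor) (auto simp: B_def)
  have disj: "it j b \<notin> B" if "b \<in> B" "j \<in> {1, 2, 3}" for b j
    using that unfolding B_def by blast
  obtain r where r: "loc_const X r" "\<And>b. b \<in> B \<Longrightarrow> 0 < r b" and g: "bij_betw (\<lambda>b. it (r b) b) B B"
    using first_return[OF B(1) B_lc B(2)] by blast
  let ?g = "\<lambda>b. it (r b) b"
  show ?thesis
  proof (rule ccontr)
    assume no: "\<not> ?thesis"
    have "\<exists>p>0. \<forall>b\<in>B. (?g ^^ p) b \<in> E \<longleftrightarrow> b \<in> E" if E: "E \<subseteq> B" "loc_const X (\<lambda>x. x \<in> E)" for E
    proof (rule ccontr)
      assume "\<not> ?thesis"
      then have "\<forall>p. p = 0 \<or> (\<exists>b\<in>B. (?g ^^ p) b \<in> E \<longleftrightarrow> b \<notin> E)"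
        by simp
      then have "\<exists>b\<in>B. (?g ^^ p) b \<in> E \<longleftrightarrow> b \<notin> E" if "0 < p" for p
        using that by (metis less_not_refl)
      then show False
        using no commutator_subgroup_contains_lamplighter_group_if_aperiodic[OF B(1) B_lc disj r(1) g E]
        by blast
    qed
    moreover have "?g ` B \<subseteq> B" using g by (simp add: bij_betw_def)
    ultimately have "is_odometer X \<phi>"
      by (intro is_odometer_if_periodic periodic_if_return_map_periodic[OF B(1) B_lc B(2) r])
    then show False using assms by contradiction
  qed
qed

section \<open>From the commutator subgroup to the full group\<close>

lemma contains_copy_of_commutator_subgroup:
  assumes "contains_copy_of (commutator_subgroup G) lamplighter_group"
  shows "contains_copy_of G lamplighter_group"
proof -
  obtain \<Phi> where \<Phi>: "\<Phi> \<in> hom lamplighter_group (commutator_subgroup G)"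
    "inj_on \<Phi> (carrier lamplighter_group)"
    using assms by (rule contains_copy_ofE)
  have "carrier (commutator_subgroup G) \<subseteq> carrier G"
    using group.group_commutator_subgroup(1)[OF group_G] by (rule subgroup.subset)
  then have "\<Phi> \<in> hom lamplighter_group G"
    using \<Phi>(1) by (auto simp: hom_def commutator_subgroup_def)
  then have "group_hom lamplighter_group G \<Phi>"
    by (simp add: group_hom_def group_hom_axioms_def group_lamplighter_group group_G)
  then show ?thesis using \<Phi>(2) by (rule contains_copy_ofI)
qed

end

theorem theorem2p4:
  fixes X :: "'a topology" and \<phi> :: "'a \<Rightarrow> 'a"
  assumes "cantor_minimal_system X \<phi>"
  shows "(\<not> is_odometer X \<phi> \<longleftrightarrow>
            contains_copy_of (commutator_subgroup (full_group X \<phi>)) lamplighter_group) \<and>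
         (contains_copy_of (commutator_subgroup (full_group X \<phi>)) lamplighter_group \<longleftrightarrow>
            contains_copy_of (full_group X \<phi>) lamplighter_group)"
proof -
  interpret cantor_minimal X \<phi> by unfold_locales (rule assms)
  show ?thesis
    using odometer_not_contains_lamplighter_group not_odometer_contains_lamplighter_group
      contains_copy_of_commutator_subgroup by blast
qed

end
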